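(* Suppose that the following hold. (M) $X$ is an irreducible, time-homogeneous Markov chain on an unbounded, uniformly locally finite state space $\mathcal{X}\subseteq\mathbb{R}_+$, whose elements listed in increasing order are $0=s_0<s_1<s_2<\cdots$, and there exist $k_0,m_0\in\mathbb{N}$ and $\delta_0>0$ such that for all $k\ge k_0$ there is $m=m(k)$ with $1\le m\le m_0$ for which \[ \Pr\Bigl(X_m=s_{k+1},\ \max_{0\le\ell\le m-1}X_\ell\le s_k\ \Big|\ X_0=s_k\Bigr)>\delta_0 . \] (B) There is a constant $B<\infty$ such that $\Pr(|X_{n+1}-X_n|\le B)=1$ for all $n\in\mathbb{Z}_+$. (V) $\liminf_{x\to\infty}\mu_2(x)>0$. Suppose also that there exist constants $x_0\in\mathbb{R}_+$ and $D<\infty$ such that \[ \mu_1(x)\ge 0\quad\text{and}\quad 2x\mu_1(x)-\mu_2(x)\le\frac{D}{\log x},\quad\text{for all }x\ge x_0 . \] Then $\Pr(\#\mathcal{C}<\infty)=1$.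
   Context: $\mathbb{Z}_+=\{0,1,2,\dots\}$, $\mathbb{R}_+=[0,\infty)$. $X=(X_n;n\in\mathbb{Z}_+)$ is a stochastic process adapted to (and, being Markov, Markov with respect to) a filtration $(\mathcal{F}_n;n\in\mathbb{Z}_+)$, with values in $\mathcal{X}\subset\mathbb{R}_+$; $X_0$ may be random. A set $S\subseteq\mathbb{R}_+$ is uniformly locally finite if $\sup_{x\in\mathbb{R}_+}\#(S\cap[x,x+1])<\infty$, where $\#A$ denotes the number of elements of $A$. With $\Delta_n:=X_{n+1}-X_n$, for $k=1,2$ and $x\in\mathcal{X}$ set $\mu_k(x):=\mathbb{E}(\Delta_n^k\mid X_n=x)$, so that $\mathbb{E}(\Delta_n^k\mid\mathcal{F}_n)=\mu_k(X_n)$ a.s. Conditions on $\mu_k(x)$ are for $x\in\mathcal{X}$. A point $x\in\mathbb{R}_+$ is a cutpoint for $X$ if there exists $n_0\in\mathbb{Z}_+$ such that $X_n\le x$ for all $n\le n_0$, $X_{n_0}=x$, and $X_n>x$ for all $n>n_0$. $\mathcal{C}$ is the (random) set of cutpoints. *)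

theory Defs
  imports "HOL-Probability.Probability"
begin

definition uniformly_locally_finite :: "real set \<Rightarrow> bool" where
  "uniformly_locally_finite S \<longleftrightarrow>
     (\<exists>N::nat. \<forall>x\<ge>0. finite (S \<inter> {x..x + 1}) \<and> card (S \<inter> {x..x + 1}) \<le> N)"

text \<open>
  A time-homogeneous Markov chain with countable state space \<open>S\<close> is given together with its
  one-step transition probabilities \<open>K x\<close>, for \<open>x \<in> S\<close>; the values of \<open>K\<close> outside \<open>S\<close>
  play no role. The initial value \<open>X 0\<close> may be random.
\<close>

definition markov_chain ::
  "'a measure \<Rightarrow> (nat \<Rightarrow> 'a measure) \<Rightarrow> real set \<Rightarrow> (real \<Rightarrow> real pmf) \<Rightarrow> (nat \<Rightarrow> 'a \<Rightarrow> real) \<Rightarrow> bool"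
where
  "markov_chain M F S K X \<longleftrightarrow>
     prob_space M \<and>
     filtration (space M) F \<and> (\<forall>n. subalgebra M (F n)) \<and>
     (\<forall>n. X n \<in> borel_measurable (F n)) \<and>
     (\<forall>n. \<forall>\<omega>\<in>space M. X n \<omega> \<in> S) \<and>
     (\<forall>x\<in>S. set_pmf (K x) \<subseteq> S) \<and>
     (\<forall>n. \<forall>y\<in>S. AE \<omega> in M.
        real_cond_exp M (F n) (\<lambda>\<omega>'. indicator {y} (X (Suc n) \<omega>')) \<omega> = pmf (K (X n \<omega>)) y)"

text \<open>
  \<open>path_pmf K n x\<close> is the law of the list \<open>[X 0, \<dots>, X n]\<close> for the chain with transition
  probabilities \<open>K\<close> started at \<open>X 0 = x\<close>. It is what \<open>Pr( \<cdot> | X 0 = x)\<close> refers to, and makes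
  sense also if \<open>x\<close> is not charged by the initial distribution of a given chain.
\<close>

primrec path_pmf :: "(real \<Rightarrow> real pmf) \<Rightarrow> nat \<Rightarrow> real \<Rightarrow> real list pmf" where
  "path_pmf K 0 x = return_pmf [x]"
| "path_pmf K (Suc n) x = bind_pmf (K x) (\<lambda>y. map_pmf (\<lambda>w. x # w) (path_pmf K n y))"

definition irreducible_chain :: "real set \<Rightarrow> (real \<Rightarrow> real pmf) \<Rightarrow> bool" where
  "irreducible_chain S K \<longleftrightarrow>
     (\<forall>x\<in>S. \<forall>y\<in>S. \<exists>n. \<P>(w in path_pmf K n x. w ! n = y) > 0)"

text \<open>The moments \<open>E((X (n + 1) - X n) ^ k | X n = x)\<close> of the increments.\<close>

definition increment_moment :: "(real \<Rightarrow> real pmf) \<Rightarrow> nat \<Rightarrow> real \<Rightarrow> real" where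
  "increment_moment K k x = measure_pmf.expectation (K x) (\<lambda>y. (y - x) ^ k)"

definition cutpoints :: "(nat \<Rightarrow> real) \<Rightarrow> real set" where
  "cutpoints w = {x. 0 \<le> x \<and> (\<exists>n\<^sub>0. (\<forall>n\<le>n\<^sub>0. w n \<le> x) \<and> w n\<^sub>0 = x \<and> (\<forall>n>n\<^sub>0. w n > x))}"

end

(* In the block (2^k, 2^(k+1)] the expected number of cutpoints is of order 1/k, but once there is a
   cutpoint in the block, the expected number of cutpoints in (2^k, 2^(k+2)] is at least of order k.
   So the block contains a cutpoint with probability of order at most 1/k^2, and the Borel-Cantelli
   lemma applies.

   Write e_x(y) for the probability that the chain started at y stays above x forever. The function
   -(log x)^(-a) is superharmonic for large x and a, which gives e_x(y) <= C / (x log x) for y close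
   to x, hence the first estimate. For the second one, conditionally on the lowest cutpoint x, a
   state z in (x + const, 9x/8] is a cutpoint with probability at least of order 1/(z - x): the chain
   has to hit z before returning to x, which costs at most a constant factor compared with staying
   above x until the level z, and then to escape from z. Compared at the level 2x, the escape from z
   has probability at least of order 1/x (the chain is a submartingale, so the linear function is
   subharmonic), while reaching 2x from the level z before x has probability at most of order
   (z - x)/x by the superharmonic function above. *)

theory Submission
  imports Defs "HOL-Real_Asymp.Real_Asymp"
begin

text \<open>The drift is bounded from above only, so the chain may be recurrent and all escape
  probabilities may be 0. Hence no absolute lower bound on them is available. The escapes from x and
  from z are both measured against the escape from one and the same state near 2x, and this factor
  cancels.

  A bound of order 1/k is not summable over the blocks. The second factor 1/k is a harmonic sum: the
  states z in (x + const, 9x/8] contribute 1/(z - x) each, and far out \<open>S\<close> has no gaps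
  longer than the jump bound, so the total is of order log x.

  The exponent a has to be large for this reason: applied to -(log x)^(-a), the generator is to
  leading order a positive multiple of 2 x mu_1 - mu_2 - (a + 1) mu_2 / log x. As mu_2 is bounded
  away from 0, the last term beats D / log x.

  Being the lowest cutpoint is a statement about the future, yet conditioning on it is harmless: if
  the chain stays above x after time n, then the history until n decides which lower states are
  cutpoints.

  Stopping times are avoided: probabilities are limits of finite-horizon recursions, compared by a
  maximum principle on finite sets.\<close>

section \<open>Potential theory of the transition kernel\<close>

text \<open>
  The expectation of \<open>b\<close> at the exit from \<open>V\<close>, with payoff \<open>c\<close> if the chain is still in \<open>V\<close> after
  \<open>n\<close> steps.
\<close>

primrec dirichlet ::
  "(real \<Rightarrow> real pmf) \<Rightarrow> real set \<Rightarrow> (real \<Rightarrow> real) \<Rightarrow> real \<Rightarrow> nat \<Rightarrow> real \<Rightarrow> real" where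
  "dirichlet K V b c 0 y = (if y \<in> V then c else b y)"
| "dirichlet K V b c (Suc n) y =
    (if y \<in> V then measure_pmf.expectation (K y) (dirichlet K V b c n) else b y)"

text \<open>Bounded jumps and \<open>finite_below\<close> make every \<open>avg\<close> a finite
  sum, so limits can be taken under it without domination. Irreducibility is kept as mere
  reachability, which is all that the maximum principle needs.\<close>

locale bounded_kernel =
  fixes S :: "real set" and K :: "real \<Rightarrow> real pmf" and B :: real
  assumes finite_below: "finite (S \<inter> {..r})"
    and unbounded: "\<not> bdd_above S"
    and closed: "x \<in> S \<Longrightarrow> y \<in> set_pmf (K x) \<Longrightarrow> y \<in> S"
    and jump: "x \<in> S \<Longrightarrow> y \<in> set_pmf (K x) \<Longrightarrow> \<bar>y - x\<bar> \<le> B"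
    and reach: "x \<in> S \<Longrightarrow> y \<in> S \<Longrightarrow> (x, y) \<in> {(a, b). b \<in> set_pmf (K a)}\<^sup>*"
begin

abbreviation avg :: "(real \<Rightarrow> real) \<Rightarrow> real \<Rightarrow> real" where
  "avg h x \<equiv> measure_pmf.expectation (K x) h"

lemma finite_support: "x \<in> S \<Longrightarrow> finite (set_pmf (K x))"
  by (rule finite_subset[OF _ finite_below[of "x + B"]]) (use closed jump in fastforce)

lemma integrable_kernel: "x \<in> S \<Longrightarrow> integrable (measure_pmf (K x)) (h :: real \<Rightarrow> real)"
  by (intro integrable_measure_pmf_finite finite_support)

lemma avg_mono:
  assumes "x \<in> S" "\<And>y. y \<in> S \<Longrightarrow> \<bar>y - x\<bar> \<le> B \<Longrightarrow> f y \<le> g y"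
  shows "avg f x \<le> avg g x"
  using assms closed jump
  by (intro integral_mono_AE integrable_kernel) (auto simp: AE_measure_pmf_iff)

lemma tendsto_avg:
  assumes x: "x \<in> S" and lim: "\<And>y. y \<in> S \<Longrightarrow> (\<lambda>n. h n y) \<longlonglongrightarrow> l y"
  shows "(\<lambda>n. avg (h n) x) \<longlonglongrightarrow> avg l x"
proof -
  have eq: "avg g x = (\<Sum>y\<in>set_pmf (K x). g y * pmf (K x) y)" for g
    by (rule integral_measure_pmf_real[OF finite_support[OF x]]) (auto simp: set_pmf_iff)
  show ?thesis
    unfolding eq by (intro tendsto_intros lim closed[OF x])
qed

text \<open>Where \<open>v\<close> attains a maximum over \<open>W\<close> that exceeds
  \<open>c\<close>, the inequality with \<open>avg\<close> must be an equality, so all successors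
  have the same value, and by the boundary condition they lie in \<open>W\<close> again. The maximum
  thus spreads along every path, but by irreducibility some path leaves the finite set
  \<open>W\<close>.\<close>

lemma maximum_principle:
  assumes W: "finite W" "W \<subseteq> S"
    and sub: "\<And>y. y \<in> W \<Longrightarrow> v y \<le> avg v y"
    and boundary: "\<And>y y'. y \<in> W \<Longrightarrow> y' \<in> S - W \<Longrightarrow> \<bar>y' - y\<bar> \<le> B \<Longrightarrow> v y' \<le> c"
    and y: "y \<in> W"
  shows "v y \<le> c"
proof (rule ccontr)
  assume "\<not> v y \<le> c"
  define m where "m = Max (v ` W)"
  have le_m: "v u \<le> m" if "u \<in> W" for u
    unfolding m_def using W that by auto
  have "c < m"
    using le_m[OF y] \<open>\<not> v y \<le> c\<close> by simp
  have spread: "y' \<in> W \<and> v y' = m" if u: "u \<in> W" "v u = m" and y': "y' \<in> set_pmf (K u)" for u y'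
  proof -
    have uS: "u \<in> S" using u W by auto
    have le: "v z \<le> m" if "z \<in> set_pmf (K u)" for z
      using le_m[of z] boundary[OF u(1), of z] closed[OF uS that] jump[OF uS that] \<open>c < m\<close>
      by (cases "z \<in> W") auto
    have "avg (\<lambda>z. m - v z) u = m - avg v u"
      by (simp add: integrable_kernel[OF uS])
    moreover have "0 \<le> avg (\<lambda>z. m - v z) u"
      by (rule integral_nonneg_AE) (use le in \<open>auto simp: AE_measure_pmf_iff\<close>)
    ultimately have "avg (\<lambda>z. m - v z) u = 0"
      using sub[OF u(1)] u(2) by simp
    then have "AE z in measure_pmf (K u). m - v z = 0"
      by (subst (asm) integral_nonneg_eq_0_iff_AE)
         (use le in \<open>auto simp: AE_measure_pmf_iff integrable_kernel[OF uS]\<close>)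
    then have "v y' = m"
      using y' by (auto simp: AE_measure_pmf_iff)
    then show ?thesis
      using boundary[OF u(1), of y'] closed[OF uS y'] jump[OF uS y'] \<open>c < m\<close> by fastforce
  qed
  have "m \<in> v ` W"
    unfolding m_def using W y by (intro Max_in) auto
  then obtain u where u: "u \<in> W" "v u = m" by auto
  have "\<not> S \<subseteq> W"
  proof
    assume "S \<subseteq> W"
    then have "bdd_above S"
      by (rule bdd_above_finite[OF finite_subset[OF _ W(1)]])
    with unbounded show False ..
  qed
  then obtain t where t: "t \<in> S" "t \<notin> W"
    by auto
  have "(u, t) \<in> {(a, b). b \<in> set_pmf (K a)}\<^sup>*"
    using reach u t W by auto
  then have "t \<in> W \<and> v t = m"
  proof (induction rule: rtrancl_induct)
    case (step y z)
    then show ?case using spread[of y z] by blast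
  qed (use u in simp)
  then show False using t by simp
qed

lemma dirichlet_outside: "y \<notin> V \<Longrightarrow> dirichlet K V b c n y = b y"
  by (cases n) auto

lemma dirichlet_bounds:
  assumes "\<And>y. 0 \<le> b y" "\<And>y. b y \<le> 1" "0 \<le> c" "c \<le> 1" "y \<in> S"
  shows "0 \<le> dirichlet K V b c n y \<and> dirichlet K V b c n y \<le> 1"
  using \<open>y \<in> S\<close>
proof (induction n arbitrary: y)
  case (Suc n)
  have "avg (\<lambda>_. 0) y \<le> avg (dirichlet K V b c n) y" "avg (dirichlet K V b c n) y \<le> avg (\<lambda>_. 1) y"
    by (rule avg_mono; use Suc in auto)+
  then show ?case using assms by simp
qed (use assms in auto)

text \<open>Being still in \<open>V\<close> at the horizon pays the least possible value 0, so a
  later horizon can only help. With payoff 1 the order is reversed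
  (\<open>dirichlet_decseq\<close>). Monotonicity is what makes the limits \<open>hit\<close> and
  \<open>escape\<close> exist.\<close>

lemma dirichlet_incseq:
  assumes "\<And>y. 0 \<le> b y" "\<And>y. b y \<le> 1" "y \<in> S"
  shows "dirichlet K V b 0 n y \<le> dirichlet K V b 0 (Suc n) y"
  using \<open>y \<in> S\<close>
proof (induction n arbitrary: y)
  case 0
  have "avg (\<lambda>_. 0) y \<le> avg (dirichlet K V b 0 0) y"
    by (rule avg_mono) (use 0 assms in auto)
  then show ?case by simp
next
  case (Suc n)
  have "avg (dirichlet K V b 0 n) y \<le> avg (dirichlet K V b 0 (Suc n)) y"
    by (rule avg_mono[OF Suc.prems Suc.IH])
  then show ?case by (subst (1 2) dirichlet.simps) simp
qed

lemma dirichlet_decseq: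
  assumes "\<And>y. 0 \<le> b y" "\<And>y. b y \<le> 1" "y \<in> S"
  shows "dirichlet K V b 1 (Suc n) y \<le> dirichlet K V b 1 n y"
  using \<open>y \<in> S\<close>
proof (induction n arbitrary: y)
  case 0
  have "avg (dirichlet K V b 1 0) y \<le> avg (\<lambda>_. 1) y"
    by (rule avg_mono) (use 0 assms in auto)
  then show ?case by simp
next
  case (Suc n)
  have "avg (dirichlet K V b 1 (Suc n)) y \<le> avg (dirichlet K V b 1 n) y"
    by (rule avg_mono[OF Suc.prems Suc.IH])
  then show ?case by (subst (1 2) dirichlet.simps) simp
qed

lemma dirichlet_limit_harmonic:
  assumes "\<And>y. y \<in> S \<Longrightarrow> (\<lambda>n. dirichlet K V b c n y) \<longlonglongrightarrow> l y" "y \<in> S" "y \<in> V"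
  shows "l y = avg l y"
proof -
  have "(\<lambda>n. dirichlet K V b c (Suc n) y) \<longlonglongrightarrow> avg l y"
    using tendsto_avg[OF assms(2,1)] assms(3) by simp
  then show ?thesis
    using LIMSEQ_Suc[OF assms(1)[OF assms(2)]] LIMSEQ_unique by blast
qed

section \<open>Survival and hitting probabilities as limits of finite-horizon recursions\<close>

abbreviation survival :: "real \<Rightarrow> nat \<Rightarrow> real \<Rightarrow> real" where
  "survival x \<equiv> dirichlet K {x<..} (\<lambda>_. 0) 1"

text \<open>Jumping over \<open>z\<close> counts as failure, because a visit to \<open>z\<close>
  that comes after a higher state cannot turn \<open>z\<close> into a cutpoint.\<close>

abbreviation hitting :: "real \<Rightarrow> real \<Rightarrow> nat \<Rightarrow> real \<Rightarrow> real" where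
  "hitting x z \<equiv> dirichlet K {x<..<z} (indicator {z}) 0"

text \<open>
  \<open>escape x y\<close> is the probability that the chain started at \<open>y\<close> stays in \<open>(x, \<infinity>)\<close> forever, and
  \<open>hit x z y\<close> the probability that it visits \<open>z\<close> and stays in \<open>(x, z)\<close> before that.
\<close>

definition escape :: "real \<Rightarrow> real \<Rightarrow> real" where
  "escape x y = lim (\<lambda>n. survival x n y)"

definition hit :: "real \<Rightarrow> real \<Rightarrow> real \<Rightarrow> real" where
  "hit x z y = lim (\<lambda>n. hitting x z n y)"

lemma survival_bounds: "y \<in> S \<Longrightarrow> 0 \<le> survival x n y \<and> survival x n y \<le> 1"
  by (rule dirichlet_bounds) auto

lemma hitting_bounds: "y \<in> S \<Longrightarrow> 0 \<le> hitting x z n y \<and> hitting x z n y \<le> 1"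
  by (rule dirichlet_bounds) (auto simp: indicator_def)

lemma survival_tendsto:
  assumes "y \<in> S"
  shows "(\<lambda>n. survival x n y) \<longlonglongrightarrow> escape x y"
proof -
  have "decseq (\<lambda>n. survival x n y)"
    using assms by (intro decseq_SucI dirichlet_decseq) auto
  then have "convergent (\<lambda>n. survival x n y)"
    using survival_bounds[OF assms] by (metis decseq_convergent convergentI)
  then show ?thesis
    unfolding escape_def by (simp add: convergent_LIMSEQ_iff)
qed

lemma hitting_tendsto:
  assumes "y \<in> S"
  shows "(\<lambda>n. hitting x z n y) \<longlonglongrightarrow> hit x z y"
proof -
  have "incseq (\<lambda>n. hitting x z n y)"
    using assms by (intro incseq_SucI dirichlet_incseq) (auto simp: indicator_def)
  then have "convergent (\<lambda>n. hitting x z n y)"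
    using hitting_bounds[OF assms] by (metis incseq_convergent convergentI)
  then show ?thesis
    unfolding hit_def by (simp add: convergent_LIMSEQ_iff)
qed

lemma escape_bounds: "y \<in> S \<Longrightarrow> 0 \<le> escape x y" "y \<in> S \<Longrightarrow> escape x y \<le> 1"
  using survival_bounds LIMSEQ_le_const[OF survival_tendsto] LIMSEQ_le_const2[OF survival_tendsto]
  by blast+

lemma hit_bounds: "y \<in> S \<Longrightarrow> 0 \<le> hit x z y" "y \<in> S \<Longrightarrow> hit x z y \<le> 1"
  using hitting_bounds LIMSEQ_le_const[OF hitting_tendsto] LIMSEQ_le_const2[OF hitting_tendsto]
  by blast+

text \<open>In particular \<open>escape x x = 0\<close>, as survival is checked from time 0 on. The
  probability that a chain at \<open>x\<close> stays above \<open>x\<close> from the next step on is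
  \<open>avg (escape x) x\<close>.\<close>

lemma escape_below: "y \<le> x \<Longrightarrow> escape x y = 0"
  unfolding escape_def by (simp add: dirichlet_outside)

lemma hit_below: "y \<le> x \<Longrightarrow> x < z \<Longrightarrow> hit x z y = 0"
  unfolding hit_def by (simp add: dirichlet_outside)

lemma hit_target: "hit x z z = 1"
  unfolding hit_def by (simp add: dirichlet_outside)

lemma escape_harmonic: "y \<in> S \<Longrightarrow> x < y \<Longrightarrow> escape x y = avg (escape x) y"
  by (rule dirichlet_limit_harmonic[OF survival_tendsto]) auto

lemma hit_harmonic: "y \<in> S \<Longrightarrow> x < y \<Longrightarrow> y < z \<Longrightarrow> hit x z y = avg (hit x z) y"
  by (rule dirichlet_limit_harmonic[OF hitting_tendsto]) auto

lemma escape_nonneg_avg: "y \<in> S \<Longrightarrow> 0 \<le> avg (escape x) y"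
  using avg_mono[of y "\<lambda>_. 0" "escape x"] escape_bounds by simp

section \<open>Finite paths and the cost of moving upwards\<close>

lemma path_stays_close:
  assumes "x \<in> S" "w \<in> set_pmf (path_pmf K m x)" "l \<le> m"
  shows "w ! l \<in> S \<and> \<bar>w ! l - x\<bar> \<le> real l * B"
  using assms
proof (induction m arbitrary: x w l)
  case (Suc m)
  then obtain y w' where y: "y \<in> set_pmf (K x)" "w' \<in> set_pmf (path_pmf K m y)" "w = x # w'"
    by auto
  show ?case
  proof (cases l)
    case 0
    then show ?thesis using y Suc.prems by simp
  next
    case (Suc l')
    then have IH: "w' ! l' \<in> S" "\<bar>w' ! l' - y\<bar> \<le> real l' * B"
      using Suc.IH[OF closed[OF \<open>x \<in> S\<close> y(1)] y(2)] \<open>l \<le> Suc m\<close> by auto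
    moreover have "\<bar>y - x\<bar> \<le> B"
      using jump[OF \<open>x \<in> S\<close> y(1)] .
    ultimately have "\<bar>w' ! l' - x\<bar> \<le> real l' * B + B"
      by linarith
    then show ?thesis
      unfolding y(3) \<open>l = Suc l'\<close> nth_Cons_Suc of_nat_Suc using IH(1)
      by (simp add: distrib_right add.commute)
  qed
qed auto

lemma path_steps:
  assumes "x \<in> S" "w \<in> set_pmf (path_pmf K m x)" "l < m"
  shows "\<bar>w ! Suc l - w ! l\<bar> \<le> B"
  using assms
proof (induction m arbitrary: x w l)
  case (Suc m)
  then obtain y w' where y: "y \<in> set_pmf (K x)" "w' \<in> set_pmf (path_pmf K m y)" "w = x # w'"
    by auto
  have yS: "y \<in> S" by (rule closed[OF \<open>x \<in> S\<close> y(1)])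
  show ?case
  proof (cases l)
    case 0
    have "w' ! 0 = y"
      using path_stays_close[OF yS y(2), of 0] by simp
    then show ?thesis
      using jump[OF \<open>x \<in> S\<close> y(1)] y(3) 0 by simp
  next
    case (Suc l')
    then show ?thesis
      using Suc.IH[OF yS y(2), of l'] \<open>l < Suc m\<close> y(3) by simp
  qed
qed simp

text \<open>Optional stopping in discrete form: a nonnegative function that is superharmonic on
  \<open>V\<close> is a supermartingale until the exit from \<open>V\<close>, and only the paths
  that end in \<open>t\<close> are kept. The induction conditions on the first step.\<close>

lemma superharmonic_path:
  assumes "x \<in> S" and nonneg: "\<And>y. y \<in> S \<Longrightarrow> 0 \<le> \<phi> y"
    and super: "\<And>y. y \<in> S \<Longrightarrow> y \<in> V \<Longrightarrow> avg \<phi> y \<le> \<phi> y"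
  shows "\<P>(w in path_pmf K m x. w ! m = t \<and> (\<forall>l<m. w ! l \<in> V)) * \<phi> t \<le> \<phi> x"
  using \<open>x \<in> S\<close>
proof (induction m arbitrary: x)
  case 0
  then show ?case
    using nonneg[of x] by (auto simp: measure_return_pmf indicator_def)
next
  case (Suc m)
  let ?p = "\<lambda>y. \<P>(w in path_pmf K m y. w ! m = t \<and> (\<forall>l<m. w ! l \<in> V))"
  have split: "(\<forall>l<Suc m. (x # w) ! l \<in> V) \<longleftrightarrow> x \<in> V \<and> (\<forall>l<m. w ! l \<in> V)" for w
    by (auto simp: less_Suc_eq_0_disj)
  show ?case
  proof (cases "x \<in> V")
    case True
    have "\<P>(w in path_pmf K (Suc m) x. w ! Suc m = t \<and> (\<forall>l<Suc m. w ! l \<in> V)) = avg ?p x"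
    proof -
      have "emeasure (measure_pmf (path_pmf K (Suc m) x))
          {w. w ! Suc m = t \<and> (\<forall>l<Suc m. w ! l \<in> V)} =
        (\<integral>\<^sup>+y. emeasure (measure_pmf (path_pmf K m y)) {w. w ! m = t \<and> (\<forall>l<m. w ! l \<in> V)} \<partial>K x)"
        using True by (simp add: emeasure_bind_pmf vimage_def split)
      also have "\<dots> = (\<integral>\<^sup>+y. ennreal (?p y) \<partial>K x)"
        by (simp add: measure_pmf.emeasure_eq_measure)
      also have "\<dots> = ennreal (avg ?p x)"
        by (rule nn_integral_eq_integral) (auto intro: integrable_kernel Suc.prems)
      finally show ?thesis
        by (simp add: measure_pmf.emeasure_eq_measure)
    qed
    then have "\<P>(w in path_pmf K (Suc m) x. w ! Suc m = t \<and> (\<forall>l<Suc m. w ! l \<in> V)) * \<phi> t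
        = avg (\<lambda>y. ?p y * \<phi> t) x"
      by simp
    also have "\<dots> \<le> avg \<phi> x"
      using Suc by (intro avg_mono) auto
    also have "\<dots> \<le> \<phi> x"
      using super Suc.prems True by simp
    finally show ?thesis .
  next
    case False
    have "\<P>(w in path_pmf K (Suc m) x. w ! Suc m = t \<and> (\<forall>l<Suc m. w ! l \<in> V)) = 0"
    proof -
      have start: "w ! 0 = x" if "w \<in> set_pmf (path_pmf K (Suc m) x)" for w
        using that by auto
      then have "set_pmf (path_pmf K (Suc m) x) \<inter> {w. w ! Suc m = t \<and> (\<forall>l<Suc m. w ! l \<in> V)} = {}"
      proof (intro equals0I, elim IntE CollectE conjE)
        fix w assume w: "w \<in> set_pmf (path_pmf K (Suc m) x)" "\<forall>l<Suc m. w ! l \<in> V"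
        have "w ! 0 \<in> V" using w(2) by blast
        then show False using False start[OF w(1)] by simp
      qed
      then show ?thesis
        unfolding space_measure_pmf by (simp only: UNIV_I simp_thms measure_pmf_zero_iff)
    qed
    then show ?thesis
      using nonneg Suc.prems by simp
  qed
qed

lemma bound_nonneg: "0 \<le> B"
proof -
  obtain x where "x \<in> S" using unbounded by fastforce
  moreover obtain y where "y \<in> set_pmf (K x)" using set_pmf_not_empty by fastforce
  ultimately show ?thesis using jump[of x y] by linarith
qed

text \<open>Fewer than \<open>m\<^sub>0\<close> bounded jumps precede the arrival at
  \<open>t\<close>, so the path cannot sink below \<open>w - m\<^sub>0 * B\<close>; superharmonicity
  is needed on this window only.\<close>

lemma climb_step:
  assumes w: "w \<in> S" and t: "t \<in> S" and m: "1 \<le> m" "m \<le> m\<^sub>0"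
    and prob: "\<P>(u in path_pmf K m w. u ! m = t \<and> (MAX l\<in>{0..m - 1}. u ! l) \<le> w) > \<delta>"
    and nonneg: "\<And>y. y \<in> S \<Longrightarrow> 0 \<le> \<phi> y"
    and super: "\<And>y. y \<in> S \<Longrightarrow> w - real m\<^sub>0 * B \<le> y \<Longrightarrow> y \<le> w \<Longrightarrow> avg \<phi> y \<le> \<phi> y"
  shows "\<delta> * \<phi> t \<le> \<phi> w"
proof -
  let ?V = "{w - real m\<^sub>0 * B..w}"
  have "u ! l \<in> ?V" if u: "u \<in> set_pmf (path_pmf K m w)" "(MAX l\<in>{0..m - 1}. u ! l) \<le> w" "l < m" for u l
  proof -
    have "u ! l \<le> w"
      using u(2,3) m by (subst (asm) Max_le_iff) auto
    moreover have "real l * B \<le> real m\<^sub>0 * B"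
      using u(3) m bound_nonneg by (intro mult_right_mono) auto
    ultimately show ?thesis
      using path_stays_close[OF w u(1), of l] u(3) by auto
  qed
  then have "\<P>(u in path_pmf K m w. u ! m = t \<and> (MAX l\<in>{0..m - 1}. u ! l) \<le> w)
      \<le> \<P>(u in path_pmf K m w. u ! m = t \<and> (\<forall>l<m. u ! l \<in> ?V))"
    by (intro measure_pmf.finite_measure_mono_AE) (auto simp: AE_measure_pmf_iff)
  then have "\<delta> * \<phi> t \<le> \<P>(u in path_pmf K m w. u ! m = t \<and> (\<forall>l<m. u ! l \<in> ?V)) * \<phi> t"
    using prob nonneg[OF t] by (intro mult_right_mono) auto
  also have "\<dots> \<le> \<phi> w"
    by (rule superharmonic_path[OF w nonneg]) (use super in auto)
  finally show ?thesis .
qed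

text \<open>Each passage to the next state costs a factor \<delta>. Later passages start higher up,
  so the window below \<open>s i\<close> serves for all of them.\<close>

lemma climb:
  fixes s :: "nat \<Rightarrow> real"
  assumes s: "strict_mono s" "range s = S"
    and prob: "\<And>k. k \<ge> k\<^sub>0 \<Longrightarrow> \<exists>m. 1 \<le> m \<and> m \<le> m\<^sub>0 \<and>
      \<P>(u in path_pmf K m (s k). u ! m = s (k + 1) \<and> (MAX l\<in>{0..m - 1}. u ! l) \<le> s k) > \<delta>"
    and \<delta>: "0 \<le> \<delta>"
    and "k\<^sub>0 \<le> i"
    and nonneg: "\<And>y. y \<in> S \<Longrightarrow> 0 \<le> \<phi> y"
    and super: "\<And>y. y \<in> S \<Longrightarrow> s i - real m\<^sub>0 * B \<le> y \<Longrightarrow> y < s (i + d) \<Longrightarrow> avg \<phi> y \<le> \<phi> y"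
  shows "\<delta> ^ d * \<phi> (s (i + d)) \<le> \<phi> (s i)"
  using \<open>k\<^sub>0 \<le> i\<close> super
proof (induction d arbitrary: i)
  case (Suc d)
  have less: "s i < s (Suc i)" "s i < s (i + Suc d)"
    using s(1) by (auto simp: strict_mono_less)
  have IH: "\<delta> ^ d * \<phi> (s (Suc i + d)) \<le> \<phi> (s (Suc i))"
    by (rule Suc.IH) (use Suc.prems less in auto)
  obtain m where m: "1 \<le> m" "m \<le> m\<^sub>0"
      "\<P>(u in path_pmf K m (s i). u ! m = s (i + 1) \<and> (MAX l\<in>{0..m - 1}. u ! l) \<le> s i) > \<delta>"
    using prob[OF Suc.prems(1)] by blast
  have "\<delta> * \<phi> (s (i + 1)) \<le> \<phi> (s i)"
    by (rule climb_step[OF _ _ m nonneg]) (use s Suc.prems less in auto)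
  moreover have "\<delta> ^ Suc d * \<phi> (s (i + Suc d)) \<le> \<delta> * \<phi> (s (i + 1))"
    using mult_left_mono[OF IH \<delta>] by (simp add: mult.assoc)
  ultimately show ?case by linarith
qed simp

end

section \<open>Escape probabilities\<close>

text \<open>
  Assumption \<open>climbing\<close> is the form in which the upward steps of condition (M) are used: the chain
  visits every state of a bounded interval above \<open>w\<close> with probability at least \<open>c\<close>, without going
  below \<open>w - m\<^sub>0 B\<close>.
\<close>

locale lamperti_kernel = bounded_kernel S K B
  for S K B +
  fixes c \<epsilon> C r\<^sub>0 :: real and m\<^sub>0 :: nat and f :: "real \<Rightarrow> real"
  assumes constants: "0 < c" "0 < \<epsilon>" "0 \<le> C" "1 \<le> r\<^sub>0" "0 < B"
    and climbing: "\<And>w t \<phi>. \<lbrakk>w \<in> S; t \<in> S; r\<^sub>0 \<le> w; w \<le> t; t \<le> w + 2 * B; \<And>y. y \<in> S \<Longrightarrow> 0 \<le> \<phi> y;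
        \<And>y. y \<in> S \<Longrightarrow> w - real m\<^sub>0 * B \<le> y \<Longrightarrow> y < t \<Longrightarrow> avg \<phi> y \<le> \<phi> y\<rbrakk> \<Longrightarrow> c * \<phi> t \<le> \<phi> w"
    and gap: "r\<^sub>0 \<le> r \<Longrightarrow> \<exists>t\<in>S. r < t \<and> t \<le> r + B"
    and submartingale: "x \<in> S \<Longrightarrow> r\<^sub>0 \<le> x \<Longrightarrow> x \<le> avg (\<lambda>y. y) x"
    and upward: "x \<in> S \<Longrightarrow> r\<^sub>0 \<le> x \<Longrightarrow> \<epsilon> \<le> avg (\<lambda>y. max 0 (y - x)) x"
    and f_super: "x \<in> S \<Longrightarrow> r\<^sub>0 \<le> x \<Longrightarrow> avg f x \<le> f x"
    and f_mono: "r\<^sub>0 \<le> x \<Longrightarrow> x < y \<Longrightarrow> f x < f y"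
    and f_neg: "r\<^sub>0 \<le> x \<Longrightarrow> f x < 0"
    and f_lim: "(f \<longlongrightarrow> 0) at_top"
    and f_local: "r\<^sub>0 + B \<le> x \<Longrightarrow> (f (x + B) - f (x - B)) / - f (x - B) \<le> C / (x * ln x)"
    and f_doubling: "r\<^sub>0 + B \<le> x \<Longrightarrow> x - B \<le> w \<Longrightarrow> w \<le> 2 * x \<Longrightarrow>
        f w - f (x - B) \<le> 3 * (w - x + B) / x * (f (2 * x) - f (x - B))"
begin

lemma f_mono_le: "r\<^sub>0 \<le> x \<Longrightarrow> x \<le> y \<Longrightarrow> f x \<le> f y"
  using f_mono[of x y] by (cases "x = y") auto

text \<open>Comparison with a superharmonic function \<open>g\<close>, normalised to be 0 at
  \<open>x - B\<close>, the lowest level that a jump from above \<open>x\<close> can reach, and to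
  tend to 1 at infinity. Then \<open>g y\<close> is the relative increment of \<open>f\<close> that
  \<open>f_local\<close> controls.\<close>

lemma escape_le:
  assumes x: "r\<^sub>0 + B \<le> x" and y: "y \<in> S" "y \<le> x + B"
  shows "escape x y \<le> C / (x * ln x)"
proof (cases "y \<le> x")
  case True
  moreover have "0 \<le> C / (x * ln x)"
    using x constants by auto
  ultimately show ?thesis by (simp add: escape_below)
next
  case False
  define q where "q = - f (x - B)"
  define g where "g w = (f w + q) / q" for w
  have q: "0 < q"
    unfolding q_def using f_neg[of "x - B"] x by simp
  \<comment> \<open>The maximum principle needs a finite set, hence the cut at \<open>R\<close>.
    Above \<open>R\<close> the function \<open>g\<close> falls short of 1 by at most
    \<open>- f R / q\<close>, an error that vanishes as \<open>R\<close> grows.\<close>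
  have bound: "escape x y \<le> g y - f R / q" if R: "R > y" for R
  proof -
    let ?W = "S \<inter> {x<..R}"
    have "escape x y - g y \<le> - f R / q"
    proof (rule maximum_principle[where W = ?W and v = "\<lambda>y. escape x y - g y"])
      show "finite ?W"
        by (rule finite_subset[OF _ finite_below[of R]]) auto
    next
      fix u assume u: "u \<in> ?W"
      then have "avg f u \<le> f u"
        using x constants by (intro f_super) auto
      then have "avg g u \<le> g u"
        using q u unfolding g_def by (simp add: integrable_kernel divide_right_mono)
      then show "escape x u - g u \<le> avg (\<lambda>y. escape x y - g y) u"
        using u escape_harmonic[of u x] by (simp add: integrable_kernel)
    next
      fix u u' assume u: "u \<in> ?W" "u' \<in> S - ?W" "\<bar>u' - u\<bar> \<le> B"
      have "f R < 0"
        using R False x constants by (intro f_neg) auto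
      then have fR: "0 \<le> - f R / q" using q by (intro divide_nonneg_pos) auto
      show "escape x u' - g u' \<le> - f R / q"
      proof (cases "u' \<le> x")
        case True
        have "f (x - B) \<le> f u'"
          using u True x by (intro f_mono_le) auto
        then have "0 \<le> f u' + q" unfolding q_def by simp
        then have "0 \<le> g u'" using q unfolding g_def by (rule divide_nonneg_pos)
        with True fR show ?thesis by (simp add: escape_below)
      next
        case False
        then have "f R \<le> f u'"
          using u R x \<open>\<not> y \<le> x\<close> constants by (intro f_mono_le) auto
        then have "1 + f R / q \<le> g u'"
          using q unfolding g_def by (simp add: field_simps)
        moreover have "escape x u' \<le> 1"
          using u by (intro escape_bounds) auto
        ultimately show ?thesis by simp
      qed
    qed (use y R False in auto)
    then show ?thesis by simp
  qed
  have "((\<lambda>R. g y - f R / q) \<longlongrightarrow> g y - 0 / q) at_top"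
    using q by (intro tendsto_intros f_lim) auto
  then have "escape x y \<le> g y - 0 / q"
    by (rule tendsto_lowerbound) (auto intro: eventually_mono[OF eventually_gt_at_top[of y]] bound)
  also have "\<dots> \<le> (f (x + B) - f (x - B)) / - f (x - B)"
    using f_mono_le[of y "x + B"] q x y False constants unfolding g_def q_def
    by (simp add: divide_le_cancel)
  also have "\<dots> \<le> C / (x * ln x)"
    by (rule f_local[OF x])
  finally show ?thesis .
qed

text \<open>All quantities are expressed through the escape probabilities \<open>H\<close> (above
  \<open>x\<close>) and \<open>e\<close> (above \<open>z\<close>) of a single state \<open>t\<close>
  near \<open>2 * x\<close>. The constant collects 2 from \<open>H_le\<close>, 6 from
  \<open>E\<close>, one \<open>c\<close> from \<open>hit_near\<close>, and another \<open>c\<close>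
  together with \<epsilon> from \<open>esc_z\<close>.\<close>

lemma escape_comparison:
  assumes x: "x \<in> S" "r\<^sub>0 + B \<le> x" "24 * B \<le> x" "2 * (real m\<^sub>0 + 1) * B \<le> x"
    and z: "z \<in> S" "x + (real m\<^sub>0 + 2) * B \<le> z" "z \<le> 9 / 8 * x"
  shows "avg (escape x) x \<le>
    12 / (c\<^sup>2 * \<epsilon>) * (z - x) * avg (escape z) z * avg (hit x z) x"
proof -
  define L where "L = 2 * x"
  \<comment> \<open>A chain that crosses \<open>L\<close> upwards lands in this window;
    \<open>t\<close> will be its state with the best chance to stay above \<open>x\<close>.\<close>
  let ?T = "S \<inter> {L..L + B}"
  have pos: "0 < x" "0 < B" "0 \<le> real m\<^sub>0 * B" "r\<^sub>0 < x"
    using x constants by auto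
  have mB: "x + real m\<^sub>0 * B + 2 * B \<le> z" "2 * (real m\<^sub>0 * B) + 2 * B \<le> x"
    using z x by (auto simp: algebra_simps)
  then have xz: "x < z" "x + 2 * B \<le> z"
    using pos by linarith+
  have "finite ?T"
    by (rule finite_subset[OF _ finite_below[of "L + B"]]) auto
  moreover have "?T \<noteq> {}"
    using gap[of L] pos unfolding L_def by fastforce
  ultimately have "Max (escape x ` ?T) \<in> escape x ` ?T"
    by (intro Max_in) auto
  then obtain t where t: "t \<in> ?T" "escape x t = Max (escape x ` ?T)"
    by auto
  define H where "H = escape x t"
  have H_max: "escape x w \<le> H" if "w \<in> ?T" for w
    unfolding H_def t(2) using that \<open>finite ?T\<close> by auto
  have H: "0 \<le> H"
    unfolding H_def using t(1) escape_bounds(1)[of t x] by simp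
  define e where "e = escape z t"
  have e: "0 \<le> e"
    unfolding e_def using t(1) escape_bounds(1)[of t z] by simp

  \<comment> \<open>Here \<open>f\<close> is normalised to be 0 at \<open>x - B\<close> and 1 at
    \<open>L\<close>; \<open>f_doubling\<close> then replaces it by a linear bound.\<close>
  have upper: "escape x w \<le> H * (3 * (w - x + B) / x)" if w: "w \<in> S" "x < w" "w < L" for w
  proof -
    define q where "q = f L - f (x - B)"
    define g where "g w = (f w - f (x - B)) / q" for w
    have q: "0 < q"
      unfolding q_def using f_mono[of "x - B" L] x pos by (auto simp: L_def)
    have "escape x w - H * g w \<le> 0"
    proof (rule maximum_principle[where W = "S \<inter> {x<..<L}" and v = "\<lambda>y. escape x y - H * g y"])
      show "finite (S \<inter> {x<..<L})"
        by (rule finite_subset[OF _ finite_below[of L]]) auto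
    next
      fix u assume u: "u \<in> S \<inter> {x<..<L}"
      then have "avg f u \<le> f u"
        using pos by (intro f_super) auto
      then have "avg g u \<le> g u"
        using q u unfolding g_def by (simp add: integrable_kernel divide_right_mono)
      then have "H * avg g u \<le> H * g u"
        using H by (rule mult_left_mono)
      then show "escape x u - H * g u \<le> avg (\<lambda>y. escape x y - H * g y) u"
        using u escape_harmonic[of u x] by (simp add: integrable_kernel)
    next
      fix u u' assume u: "u \<in> S \<inter> {x<..<L}" "u' \<in> S - S \<inter> {x<..<L}" "\<bar>u' - u\<bar> \<le> B"
      show "escape x u' - H * g u' \<le> 0"
      proof (cases "u' \<le> x")
        case True
        have "f (x - B) \<le> f u'"
          using u True x by (intro f_mono_le) auto
        then have "0 \<le> g u'" using q unfolding g_def by simp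
        with True H show ?thesis by (simp add: escape_below)
      next
        case False
        then have "f L \<le> f u'"
          using u pos by (intro f_mono_le) (auto simp: L_def)
        then have "1 \<le> g u'"
          using q unfolding g_def q_def by (simp add: field_simps)
        then have "H * 1 \<le> H * g u'"
          using H by (rule mult_left_mono)
        moreover have "escape x u' \<le> H"
          using u False by (intro H_max) auto
        ultimately show ?thesis by simp
      qed
    qed (use w in auto)
    moreover have "g w \<le> 3 * (w - x + B) / x"
      using f_doubling[OF x(2), of w] w pos q
      unfolding g_def q_def L_def by (simp add: pos_divide_le_eq)
    then have "H * g w \<le> H * (3 * (w - x + B) / x)"
      using H by (rule mult_left_mono)
    ultimately show ?thesis by simp
  qed
  have zL: "z + 2 * B \<le> L" "L - z \<le> x"
    using z(3) x(3) pos mB xz unfolding L_def by linarith+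

  \<comment> \<open>Origin of 9/8 and 24: the factor is at most 3 (1/8 + B/x), and B/x is at most
    1/24.\<close>
  have half: "escape x w \<le> H / 2" if w: "w \<in> S" "w \<le> z" for w
  proof (cases "w \<le> x")
    case False
    have "escape x w \<le> H * (3 * (w - x + B) / x)"
      using w False zL pos by (intro upper) auto
    also have "3 * (w - x + B) / x \<le> 1 / 2"
      using w z x pos by (simp add: field_simps)
    then have "H * (3 * (w - x + B) / x) \<le> H * (1 / 2)"
      using H by (rule mult_left_mono)
    finally show ?thesis by simp
  qed (use H in \<open>simp add: escape_below\<close>)

  \<comment> \<open>A chain that stays above \<open>x\<close> either stays above \<open>z\<close>, or visits a state below \<open>z\<close> and then
    escapes from there, which has probability at most \<open>H / 2\<close>.\<close>
  have approx: "escape x w \<le> survival z n w + H / 2" if "w \<in> S" for n w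
    using that
  proof (induction n arbitrary: w)
    case 0
    show ?case
    proof (cases "w \<le> z")
      case False
      with H escape_bounds(2)[OF 0, of x] show ?thesis by simp
    qed (use 0 half H in auto)
  next
    case (Suc n)
    show ?case
    proof (cases "w \<le> z")
      case False
      then have "escape x w = avg (escape x) w"
        using Suc.prems xz by (intro escape_harmonic) auto
      also have "\<dots> \<le> avg (\<lambda>y. survival z n y + H / 2) w"
        by (rule avg_mono[OF Suc.prems]) (use Suc.IH in auto)
      also have "\<dots> = survival z (Suc n) w + H / 2"
        using False Suc.prems by (simp add: integrable_kernel)
      finally show ?thesis .
    qed (use Suc.prems half H in auto)
  qed
  \<comment> \<open>At the maximiser \<open>t\<close> the left side of \<open>approx\<close> is
    \<open>H\<close> itself, so \<open>H / 2\<close> can be absorbed.\<close>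
  have "(\<lambda>n. survival z n t + H / 2) \<longlonglongrightarrow> e + H / 2"
    unfolding e_def using t by (intro tendsto_intros survival_tendsto) auto
  then have "H \<le> e + H / 2"
    by (rule LIMSEQ_le_const) (use approx[of t] t(1) in \<open>auto simp: H_def\<close>)
  then have H_le: "H \<le> 2 * e" by simp

  \<comment> \<open>The linear function is subharmonic by \<open>submartingale\<close>. The region
    ends at \<open>L - B\<close> so that a jump out of its top lands in \<open>(L - B, L]\<close>;
    from there \<open>t\<close> is at most \<open>2 * B\<close> higher, and climbing to it costs a
    factor \<open>c\<close> and stays above \<open>z\<close>.\<close>
  have lower: "c * e * (y - z) / x \<le> escape z y" if y: "y \<in> S" "z < y" "y \<le> L - B" for y
  proof -
    have "c * e * (y - z) / x - escape z y \<le> 0"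
    proof (rule maximum_principle[where W = "S \<inter> {z<..L - B}"
          and v = "\<lambda>y. c * e * (y - z) / x - escape z y"])
      show "finite (S \<inter> {z<..L - B})"
        by (rule finite_subset[OF _ finite_below[of L]]) (use pos in auto)
    next
      fix u assume u: "u \<in> S \<inter> {z<..L - B}"
      then have "c * e * (u - z) / x \<le> c * e * (avg (\<lambda>y. y) u - z) / x"
        using submartingale[of u] pos mB xz e constants
        by (intro divide_right_mono mult_left_mono) auto
      then show "c * e * (u - z) / x - escape z u \<le> avg (\<lambda>y. c * e * (y - z) / x - escape z y) u"
        using u escape_harmonic[of u z] by (simp add: integrable_kernel)
    next
      fix u u' assume u: "u \<in> S \<inter> {z<..L - B}" "u' \<in> S - S \<inter> {z<..L - B}" "\<bar>u' - u\<bar> \<le> B"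
      show "c * e * (u' - z) / x - escape z u' \<le> 0"
      proof (cases "u' \<le> z")
        case True
        then have "c * e * (u' - z) / x \<le> 0"
          using constants e pos by (intro divide_nonpos_pos mult_nonneg_nonpos) auto
        with True show ?thesis by (simp add: escape_below)
      next
        case False
        then have u': "L - B < u'" "u' \<le> L" using u by auto
        have "c * escape z t \<le> escape z u'"
        proof (rule climbing[where \<phi> = "escape z"])
          fix y assume "y \<in> S" "u' - real m\<^sub>0 * B \<le> y"
          moreover have "z < u' - real m\<^sub>0 * B"
            using u' mB z x pos unfolding L_def by auto
          ultimately show "avg (escape z) y \<le> escape z y"
            using escape_harmonic[of y z] by auto
        qed (use u u' t(1) pos zL xz escape_bounds in \<open>auto simp: L_def\<close>)
        moreover have "c * e * (u' - z) / x \<le> c * e * 1"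
          unfolding times_divide_eq_right[symmetric]
          using u' zL pos constants e by (intro mult_left_mono) auto
        ultimately show ?thesis unfolding e_def by simp
      qed
    qed (use y in auto)
    then show ?thesis by simp
  qed
  \<comment> \<open>One step from \<open>z\<close>: \<open>lower\<close> bounds the escape by a
    multiple of the positive part of the increment, whose mean is at least \<epsilon> by
    \<open>upward\<close>.\<close>
  have esc_z: "c * e / x * \<epsilon> \<le> avg (escape z) z"
  proof -
    have "c * e / x * \<epsilon> \<le> c * e / x * avg (\<lambda>y. max 0 (y - z)) z"
      using constants e pos z xz by (intro mult_left_mono upward) auto
    also have "\<dots> = avg (\<lambda>y. c * e / x * max 0 (y - z)) z"
      by simp
    also have "\<dots> \<le> avg (escape z) z"
    proof (rule avg_mono)
      fix y assume y: "y \<in> S" "\<bar>y - z\<bar> \<le> B"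
      show "c * e / x * max 0 (y - z) \<le> escape z y"
        using lower[of y] y zL escape_bounds(1)[of y z] by (cases "y \<le> z") auto
    qed (use z in auto)
    finally show ?thesis .
  qed

  \<comment> \<open>\<open>E\<close> bounds the escape above \<open>x\<close> from states in
    \<open>(z - B, z]\<close>: there \<open>3 * (w - x + B)\<close> is at most
    \<open>6 * (z - x)\<close>, because \<open>B \<le> z - x\<close>.\<close>
  define E where "E = H * (6 * (z - x) / x)"
  have E: "0 \<le> E"
    unfolding E_def using H xz pos by (intro mult_nonneg_nonneg divide_nonneg_pos) auto
  \<comment> \<open>The climb to \<open>z\<close> may sink by \<open>m\<^sub>0 * B\<close>; the
    assumed distance \<open>(m\<^sub>0 + 2) * B\<close> between \<open>x\<close> and
    \<open>z\<close> keeps it above \<open>x\<close>.\<close>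
  have hit_near: "c \<le> hit x z w" if w: "w \<in> S" "z - B < w" "w \<le> z" for w
  proof -
    have "c * hit x z z \<le> hit x z w"
    proof (rule climbing[where \<phi> = "hit x z"])
      fix y assume "y \<in> S" "w - real m\<^sub>0 * B \<le> y" "y < z"
      then show "avg (hit x z) y \<le> hit x z y"
        using hit_harmonic[of y x z] w mB xz pos by auto
    qed (use w z(1) xz pos(2,4) hit_bounds in auto)
    then show ?thesis by (simp add: hit_target)
  qed
  \<comment> \<open>Both functions are harmonic in \<open>(x, z - B]\<close>. A jump out of the top
    lands in \<open>(z - B, z]\<close>, where the first is at most \<open>E\<close> and
    \<open>hit\<close> at least \<open>c\<close>.\<close>
  have by_hit: "escape x w \<le> E / c * hit x z w" if w: "w \<in> S" "x < w" "w \<le> z - B" for w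
  proof -
    have "escape x w - E / c * hit x z w \<le> 0"
    proof (rule maximum_principle[where W = "S \<inter> {x<..z - B}"
          and v = "\<lambda>w. escape x w - E / c * hit x z w"])
      show "finite (S \<inter> {x<..z - B})"
        by (rule finite_subset[OF _ finite_below[of z]]) (use pos in auto)
    next
      fix u assume u: "u \<in> S \<inter> {x<..z - B}"
      then show "escape x u - E / c * hit x z u \<le> avg (\<lambda>w. escape x w - E / c * hit x z w) u"
        using escape_harmonic[of u x] hit_harmonic[of u x z] pos by (simp add: integrable_kernel)
    next
      fix u u' assume u: "u \<in> S \<inter> {x<..z - B}" "u' \<in> S - S \<inter> {x<..z - B}" "\<bar>u' - u\<bar> \<le> B"
      show "escape x u' - E / c * hit x z u' \<le> 0"
      proof (cases "u' \<le> x")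
        case True
        then show ?thesis using xz pos by (simp add: escape_below hit_below)
      next
        case False
        then have u': "z - B < u'" "u' \<le> z" "u' \<in> S" using u by auto
        have "3 * (u' - x + B) / x \<le> 6 * (z - x) / x"
          using u' xz pos by (intro divide_right_mono) auto
        then have "H * (3 * (u' - x + B) / x) \<le> E"
          unfolding E_def using H by (rule mult_left_mono)
        then have "escape x u' \<le> E"
          using upper[of u'] u' False zL pos by auto
        moreover have "E / c * c \<le> E / c * hit x z u'"
          using hit_near[of u'] u' E constants by (intro mult_left_mono) auto
        ultimately show ?thesis using constants by simp
      qed
    qed (use w in auto)
    then show ?thesis by simp
  qed
  have hit_nonneg: "0 \<le> avg (hit x z) x"
    using avg_mono[of x "\<lambda>_. 0" "hit x z"] hit_bounds x by simp
  have "avg (escape x) x \<le> avg (\<lambda>w. E / c * hit x z w) x"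
  proof (rule avg_mono)
    fix y assume y: "y \<in> S" "\<bar>y - x\<bar> \<le> B"
    show "escape x y \<le> E / c * hit x z y"
      using by_hit[of y] y xz pos E constants hit_bounds(1)[of y x z]
      by (cases "y \<le> x") (auto simp: escape_below)
  qed (use x in auto)
  also have "\<dots> = E / c * avg (hit x z) x"
    by simp
  also have "\<dots> \<le> 12 / (c\<^sup>2 * \<epsilon>) * (z - x) * avg (escape z) z * avg (hit x z) x"
  proof (rule mult_right_mono[OF _ hit_nonneg])
    have "E / c \<le> 2 * e * (6 * (z - x) / x) / c"
      unfolding E_def using H_le xz pos constants
      by (intro divide_right_mono mult_right_mono) auto
    also have "\<dots> = 12 / (c\<^sup>2 * \<epsilon>) * (z - x) * (c * e / x * \<epsilon>)"
      using constants pos by (simp add: field_simps power2_eq_square)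
    also have "\<dots> \<le> 12 / (c\<^sup>2 * \<epsilon>) * (z - x) * avg (escape z) z"
      using esc_z xz pos constants by (intro mult_left_mono) auto
    finally show "E / c \<le> 12 / (c\<^sup>2 * \<epsilon>) * (z - x) * avg (escape z) z" .
  qed
  finally show ?thesis .
qed

end

section \<open>The Lyapunov function\<close>

definition lyapunov :: "real \<Rightarrow> real \<Rightarrow> real" where
  "lyapunov a x = - (ln x powr (- a))"

text \<open>This and the next two functions are the first three derivatives of
  \<open>lyapunov a\<close>, written out.\<close>

definition lyapunov1 :: "real \<Rightarrow> real \<Rightarrow> real" where
  "lyapunov1 a x = a * ln x powr (- a - 1) / x"

definition lyapunov2 :: "real \<Rightarrow> real \<Rightarrow> real" where
  "lyapunov2 a x = - a * (ln x powr (- a - 1) + (a + 1) * ln x powr (- a - 2)) / x\<^sup>2"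

definition lyapunov3 :: "real \<Rightarrow> real \<Rightarrow> real" where
  "lyapunov3 a x = a * (2 * ln x powr (- a - 1) + 3 * (a + 1) * ln x powr (- a - 2)
     + (a + 1) * (a + 2) * ln x powr (- a - 3)) / x ^ 3"

lemma ln_powr_derivative:
  assumes "1 < x"
  shows "((\<lambda>x. ln x powr b) has_real_derivative b * ln x powr (b - 1) / x) (at x)"
  using assms by (auto intro!: derivative_eq_intros)

lemma lyapunov_derivative:
  "1 < x \<Longrightarrow> (lyapunov a has_real_derivative lyapunov1 a x) (at x)"
  unfolding lyapunov_def lyapunov1_def by (auto intro!: derivative_eq_intros ln_powr_derivative)

lemma lyapunov1_derivative:
  "1 < x \<Longrightarrow> (lyapunov1 a has_real_derivative lyapunov2 a x) (at x)"
  unfolding lyapunov1_def lyapunov2_def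
  by (auto intro!: derivative_eq_intros ln_powr_derivative simp: field_simps power2_eq_square)

lemma lyapunov2_derivative:
  "1 < x \<Longrightarrow> (lyapunov2 a has_real_derivative lyapunov3 a x) (at x)"
  unfolding lyapunov2_def lyapunov3_def
  by (auto intro!: derivative_eq_intros ln_powr_derivative
      simp: field_simps power2_eq_square power3_eq_cube)

lemma lyapunov_neg: "1 < x \<Longrightarrow> lyapunov a x < 0"
  by (simp add: lyapunov_def)

lemma lyapunov_strict_mono: "0 < a \<Longrightarrow> 1 < x \<Longrightarrow> x < y \<Longrightarrow> lyapunov a x < lyapunov a y"
  unfolding lyapunov_def by (simp add: powr_less_mono2_neg)

lemma lyapunov_tendsto: "0 < a \<Longrightarrow> (lyapunov a \<longlongrightarrow> 0) at_top"
  unfolding lyapunov_def by real_asymp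

lemma lyapunov1_antimono: "0 < a \<Longrightarrow> 1 < x \<Longrightarrow> x \<le> y \<Longrightarrow> lyapunov1 a y \<le> lyapunov1 a x"
  unfolding lyapunov1_def by (intro frac_le mult_left_mono powr_mono2') auto

lemma lyapunov1_pos: "0 < a \<Longrightarrow> 1 < x \<Longrightarrow> 0 < lyapunov1 a x"
  unfolding lyapunov1_def by simp

text \<open>Mean value theorem for a concave function: the slope lies between the derivatives at the
  two endpoints.\<close>

lemma lyapunov_diff_bounds:
  assumes "0 < a" "1 < x" "x \<le> y"
  shows "(y - x) * lyapunov1 a y \<le> lyapunov a y - lyapunov a x"
    and "lyapunov a y - lyapunov a x \<le> (y - x) * lyapunov1 a x"
proof -
  have "\<exists>t. x \<le> t \<and> t \<le> y \<and> lyapunov a y - lyapunov a x = (y - x) * lyapunov1 a t"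
  proof (cases "x = y")
    case False
    then have "x < y" using assms by simp
    then have "\<exists>t. x < t \<and> t < y \<and> lyapunov a y - lyapunov a x = (y - x) * lyapunov1 a t"
      by (rule MVT2) (use assms lyapunov_derivative[of _ a] in auto)
    then show ?thesis by (auto intro: less_imp_le)
  qed auto
  then obtain t where t: "x \<le> t" "t \<le> y" "lyapunov a y - lyapunov a x = (y - x) * lyapunov1 a t"
    by blast
  then show "(y - x) * lyapunov1 a y \<le> lyapunov a y - lyapunov a x"
    "lyapunov a y - lyapunov a x \<le> (y - x) * lyapunov1 a x"
    using assms lyapunov1_antimono[of a] by (auto intro!: mult_left_mono)
qed

text \<open>The logarithmic derivative of \<open>ln x powr (- a)\<close> has absolute value
  \<open>a / (x * ln x)\<close>, and the interval has length \<open>2 * B\<close>. The generous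
  factor 8 absorbs the passage from \<open>x - B\<close> to \<open>x\<close>.\<close>

lemma lyapunov_local:
  assumes "0 < a" "0 < B"
  shows "\<forall>\<^sub>F x in at_top. (lyapunov a (x + B) - lyapunov a (x - B)) / - lyapunov a (x - B)
    \<le> 8 * a * B / (x * ln x)"
proof -
  have "\<forall>\<^sub>F x in at_top. 2 * B / ((x - B) * ln (x - B)) \<le> 8 * B / (x * ln x)"
    using assms by real_asymp
  moreover have "\<forall>\<^sub>F x in at_top. x > B + 1"
    by (rule eventually_gt_at_top)
  ultimately show ?thesis
  proof eventually_elim
    case (elim x)
    have "(lyapunov a (x + B) - lyapunov a (x - B)) / - lyapunov a (x - B)
        \<le> (x + B - (x - B)) * lyapunov1 a (x - B) / - lyapunov a (x - B)"
      using elim assms lyapunov_neg[of "x - B" a]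
      by (intro divide_right_mono lyapunov_diff_bounds) auto
    also have "\<dots> = a * (2 * B / ((x - B) * ln (x - B)))"
      using elim assms unfolding lyapunov1_def lyapunov_def
      by (simp add: powr_diff field_simps)
    also have "\<dots> \<le> a * (8 * B / (x * ln x))"
      using elim assms by (intro mult_left_mono) auto
    finally show ?case by (simp add: mult_ac)
  qed
qed

text \<open>Between \<open>x - B\<close> and \<open>2 * x\<close> the derivative drops by a factor
  that tends to 2, so 3 suffices eventually. On this range \<open>lyapunov a\<close> is therefore
  comparable with a linear function.\<close>

lemma lyapunov_doubling:
  assumes "0 < a" "0 < B"
  shows "\<forall>\<^sub>F x in at_top. \<forall>w. x - B \<le> w \<longrightarrow> w \<le> 2 * x \<longrightarrow>
    lyapunov a w - lyapunov a (x - B) \<le>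
      3 * (w - x + B) / x * (lyapunov a (2 * x) - lyapunov a (x - B))"
proof -
  have "\<forall>\<^sub>F x in at_top. lyapunov1 a (x - B) \<le> 3 * lyapunov1 a (2 * x)"
    unfolding lyapunov1_def using assms by real_asymp
  moreover have "\<forall>\<^sub>F x in at_top. x > B + 1"
    by (rule eventually_gt_at_top)
  ultimately show ?thesis
  proof eventually_elim
    case (elim x)
    show ?case
    proof (intro allI impI)
      fix w assume w: "x - B \<le> w" "w \<le> 2 * x"
      have "x * lyapunov1 a (2 * x) \<le> (2 * x - (x - B)) * lyapunov1 a (2 * x)"
        using elim assms lyapunov1_pos[of a "2 * x"] by (intro mult_right_mono) auto
      also have "\<dots> \<le> lyapunov a (2 * x) - lyapunov a (x - B)"
        using elim assms by (intro lyapunov_diff_bounds) auto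
      finally have *: "x * lyapunov1 a (2 * x) \<le> lyapunov a (2 * x) - lyapunov a (x - B)" .
      have "lyapunov a w - lyapunov a (x - B) \<le> (w - (x - B)) * lyapunov1 a (x - B)"
        using elim assms w by (intro lyapunov_diff_bounds) auto
      also have "\<dots> \<le> (w - (x - B)) * (3 * lyapunov1 a (2 * x))"
        using elim w by (intro mult_left_mono) auto
      also have "\<dots> = 3 * (w - x + B) / x * (x * lyapunov1 a (2 * x))"
        using elim assms by (simp add: field_simps)
      also have "\<dots> \<le> 3 * (w - x + B) / x * (lyapunov a (2 * x) - lyapunov a (x - B))"
        using elim assms w * by (intro mult_left_mono) auto
      finally show "lyapunov a w - lyapunov a (x - B) \<le>
        3 * (w - x + B) / x * (lyapunov a (2 * x) - lyapunov a (x - B))" .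
    qed
  qed
qed

text \<open>The remainder is smaller by a factor of order (ln x)/x than the term with
  \<open>ln x powr (- a - 2)\<close> in the second derivative, which has to survive later. As the
  third derivative is positive, \<open>(y - x) ^ 3 \<le> B ^ 3\<close> is enough for an upper
  bound.\<close>

lemma lyapunov_taylor:
  assumes "0 < a" "0 < B"
  shows "\<exists>G\<ge>0. \<forall>\<^sub>F x in at_top. \<forall>y. \<bar>y - x\<bar> \<le> B \<longrightarrow>
    lyapunov a y \<le> lyapunov a x + lyapunov1 a x * (y - x) + lyapunov2 a x / 2 * (y - x)\<^sup>2
      + G * ln x powr (- a - 1) / x ^ 3"
proof -
  define c where "c = a * (2 + 3 * (a + 1) + (a + 1) * (a + 2)) * B ^ 3"
  have c: "0 \<le> c" unfolding c_def using assms by auto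
  have "\<forall>\<^sub>F x in at_top. ln (x - B) powr (- a - 1) / (x - B) ^ 3 \<le> 2 * ln x powr (- a - 1) / x ^ 3"
    using assms by real_asymp
  \<comment> \<open>This gives \<open>1 \<le> ln t\<close> for all intermediate points
    \<open>t\<close>, so that the power with exponent \<open>- a - 1\<close> dominates the two lower
    ones.\<close>
  moreover have "\<forall>\<^sub>F x in at_top. x > B + exp 1"
    by (rule eventually_gt_at_top)
  ultimately have "\<forall>\<^sub>F x in at_top. \<forall>y. \<bar>y - x\<bar> \<le> B \<longrightarrow>
    lyapunov a y \<le> lyapunov a x + lyapunov1 a x * (y - x) + lyapunov2 a x / 2 * (y - x)\<^sup>2
      + (2 * c) * ln x powr (- a - 1) / x ^ 3"
  proof eventually_elim
    case (elim x)
    have x: "1 < x - B"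
      using elim exp_ge_add_one_self[of "1 :: real"] by linarith
    show ?case
    proof (intro allI impI)
      fix y assume y: "\<bar>y - x\<bar> \<le> B"
      let ?d = "\<lambda>n::nat. if n = 0 then lyapunov a else if n = 1 then lyapunov1 a
        else if n = 2 then lyapunov2 a else lyapunov3 a"
      show "lyapunov a y \<le> lyapunov a x + lyapunov1 a x * (y - x) + lyapunov2 a x / 2 * (y - x)\<^sup>2
        + (2 * c) * ln x powr (- a - 1) / x ^ 3"
      proof (cases "y = x")
        case True
        then show ?thesis using x c assms by simp
      next
        case False
        have "\<exists>t. (if y < x then y < t \<and> t < x else x < t \<and> t < y) \<and>
          lyapunov a y = (\<Sum>m<3. ?d m x / fact m * (y - x) ^ m) + ?d 3 t / fact 3 * (y - x) ^ 3"
        proof (rule Taylor[where a = "x - B" and b = "x + B"])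
          show "\<forall>m t. m < 3 \<and> x - B \<le> t \<and> t \<le> x + B \<longrightarrow>
              ((?d m) has_real_derivative ?d (Suc m) t) (at t)"
            using x lyapunov_derivative[of _ a] lyapunov1_derivative[of _ a] lyapunov2_derivative[of _ a]
            by (auto simp: less_Suc_eq numeral_3_eq_3 numeral_2_eq_2)
        qed (use y False in auto)
        then obtain t where t: "x - B \<le> t" "t \<le> x + B"
          "lyapunov a y = (\<Sum>m<3. ?d m x / fact m * (y - x) ^ m) + ?d 3 t / fact 3 * (y - x) ^ 3"
          using y by (smt (verit))
        have lnt: "1 \<le> ln (x - B)" "ln (x - B) \<le> ln t"
          using elim t x by (auto simp: ln_ge_iff)
        have p: "ln t powr (- a - 2) \<le> ln t powr (- a - 1)" "ln t powr (- a - 3) \<le> ln t powr (- a - 1)"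
          using lnt by (auto intro!: powr_mono)
        have "lyapunov3 a t \<le> a * (2 * ln t powr (- a - 1) + 3 * (a + 1) * ln t powr (- a - 1)
            + (a + 1) * (a + 2) * ln t powr (- a - 1)) / t ^ 3"
          unfolding lyapunov3_def using assms t x p
          by (intro divide_right_mono mult_left_mono add_mono) auto
        also have "\<dots> = a * (2 + 3 * (a + 1) + (a + 1) * (a + 2)) * (ln t powr (- a - 1) / t ^ 3)"
          by (simp add: field_simps)
        also have "\<dots> \<le> a * (2 + 3 * (a + 1) + (a + 1) * (a + 2)) *
            (ln (x - B) powr (- a - 1) / (x - B) ^ 3)"
          using assms lnt t x
          by (intro mult_left_mono frac_le powr_mono2' power_mono) auto
        also have "\<dots> \<le> a * (2 + 3 * (a + 1) + (a + 1) * (a + 2)) *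
            (2 * ln x powr (- a - 1) / x ^ 3)"
          using assms elim by (intro mult_left_mono) auto
        finally have third: "lyapunov3 a t \<le> a * (2 + 3 * (a + 1) + (a + 1) * (a + 2)) *
            (2 * ln x powr (- a - 1) / x ^ 3)" .
        have "0 \<le> lyapunov3 a t"
          unfolding lyapunov3_def using assms t x by auto
        moreover have "(y - x) ^ 3 \<le> B ^ 3"
          using y by (intro power_mono_odd) auto
        ultimately have "lyapunov3 a t * (y - x) ^ 3 \<le> lyapunov3 a t * B ^ 3"
          by (intro mult_left_mono)
        also have "\<dots> \<le> a * (2 + 3 * (a + 1) + (a + 1) * (a + 2)) *
            (2 * ln x powr (- a - 1) / x ^ 3) * B ^ 3"
          using third assms by (intro mult_right_mono) auto
        also have "\<dots> = (2 * c) * ln x powr (- a - 1) / x ^ 3"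
          unfolding c_def by (simp add: field_simps)
        finally have "lyapunov3 a t * (y - x) ^ 3 \<le> (2 * c) * ln x powr (- a - 1) / x ^ 3" .
        moreover have "0 \<le> (2 * c) * ln x powr (- a - 1) / x ^ 3"
          using c x assms by auto
        moreover have "u / 6 \<le> v" if "u \<le> v" "0 \<le> v" for u v :: real
          using that by simp
        ultimately have "lyapunov3 a t * (y - x) ^ 3 / 6 \<le> (2 * c) * ln x powr (- a - 1) / x ^ 3"
          by blast
        then have "lyapunov3 a t / fact 3 * (y - x) ^ 3 \<le> (2 * c) * ln x powr (- a - 1) / x ^ 3"
          by (simp add: fact_numeral)
        then show ?thesis
          using t(3) by (simp add: numeral_3_eq_3 numeral_2_eq_2)
      qed
    qed
  qed
  then show ?thesis
    using c by (intro exI[of _ "2 * c"]) auto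
qed

text \<open>With the factor \<open>q\<close> taken out, the expansion reads 2 x mu_1 - mu_2 - (a +
  1) mu_2 / ln x + 2 G / (a x). The choice of \<open>a\<close> makes the third term at least (D + 1)
  / ln x: the part D / ln x pays for the drift, the spare 1 / ln x for the Taylor remainder.
  Quantifying over all laws \<open>p\<close> makes the threshold for \<open>x\<close> independent of
  the kernel.\<close>

lemma lyapunov_supermartingale:
  assumes "0 < a" "0 < B" "D + 1 \<le> (a + 1) * \<epsilon>"
  shows "\<forall>\<^sub>F x in at_top. \<forall>p :: real pmf. finite (set_pmf p) \<longrightarrow>
    (\<forall>y\<in>set_pmf p. \<bar>y - x\<bar> \<le> B) \<longrightarrow>
    \<epsilon> \<le> measure_pmf.expectation p (\<lambda>y. (y - x) ^ 2) \<longrightarrow>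
    2 * x * measure_pmf.expectation p (\<lambda>y. (y - x) ^ 1) -
      measure_pmf.expectation p (\<lambda>y. (y - x) ^ 2) \<le> D / ln x \<longrightarrow>
    measure_pmf.expectation p (lyapunov a) \<le> lyapunov a x"
proof -
  obtain G where G: "0 \<le> G" "\<forall>\<^sub>F x in at_top. \<forall>y. \<bar>y - x\<bar> \<le> B \<longrightarrow>
    lyapunov a y \<le> lyapunov a x + lyapunov1 a x * (y - x) + lyapunov2 a x / 2 * (y - x)\<^sup>2
      + G * ln x powr (- a - 1) / x ^ 3"
    using lyapunov_taylor[OF assms(1,2)] by blast
  have "\<forall>\<^sub>F x in at_top. 2 * G / (a * x) \<le> 1 / ln x"
    using assms G(1) by real_asymp
  moreover have "\<forall>\<^sub>F x::real in at_top. x > 1"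
    by (rule eventually_gt_at_top)
  ultimately show ?thesis
    using G(2)
  proof eventually_elim
    case (elim x)
    show ?case
    proof (intro allI impI)
      fix p :: "real pmf"
      let ?E = "measure_pmf.expectation p"
      let ?m\<^sub>1 = "?E (\<lambda>y. (y - x) ^ 1)" and ?m\<^sub>2 = "?E (\<lambda>y. (y - x) ^ 2)"
      assume p: "finite (set_pmf p)" "\<forall>y\<in>set_pmf p. \<bar>y - x\<bar> \<le> B"
        and \<epsilon>: "\<epsilon> \<le> ?m\<^sub>2" and drift: "2 * x * ?m\<^sub>1 - ?m\<^sub>2 \<le> D / ln x"
      define q where "q = a * ln x powr (- a - 1) / (2 * x\<^sup>2)"
      have int: "integrable (measure_pmf p) h" for h :: "real \<Rightarrow> real"
        by (rule integrable_measure_pmf_finite[OF p(1)])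
      have "?E (lyapunov a) \<le> ?E (\<lambda>y. lyapunov a x + lyapunov1 a x * (y - x) ^ 1
          + lyapunov2 a x / 2 * (y - x)\<^sup>2 + G * ln x powr (- a - 1) / x ^ 3)"
        using elim p by (intro integral_mono_AE int) (auto simp: AE_measure_pmf_iff)
      also have "\<dots> = lyapunov a x + lyapunov1 a x * ?m\<^sub>1 + lyapunov2 a x / 2 * ?m\<^sub>2
          + G * ln x powr (- a - 1) / x ^ 3"
        by (simp add: int)
      also have "\<dots> = lyapunov a x + q * (2 * x * ?m\<^sub>1 - ?m\<^sub>2 - (a + 1) * ?m\<^sub>2 / ln x + 2 * G / (a * x))"
      proof -
        have shift: "ln x powr (- a - 2) = ln x powr (- a - 1) / ln x"
          using elim powr_diff[of "ln x" "- a - 1" 1] by (simp add: algebra_simps)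
        have identity: "a * P / x * u + - a * (P + (a + 1) * (P / l)) / x\<^sup>2 / 2 * v + G * P / x ^ 3
            = a * P / (2 * x\<^sup>2) * (2 * x * u - v - (a + 1) * v / l + 2 * G / (a * x))"
          if "l \<noteq> 0" for P l u v
          using that elim assms by (simp add: field_simps power2_eq_square power3_eq_cube)
        have "lyapunov1 a x * ?m\<^sub>1 + lyapunov2 a x / 2 * ?m\<^sub>2 + G * ln x powr (- a - 1) / x ^ 3
            = q * (2 * x * ?m\<^sub>1 - ?m\<^sub>2 - (a + 1) * ?m\<^sub>2 / ln x + 2 * G / (a * x))"
          unfolding lyapunov1_def lyapunov2_def q_def shift by (rule identity) (use elim in simp)
        then show ?thesis by linarith
      qed
      also have "\<dots> \<le> lyapunov a x + q * 0"
      proof -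
        have "(D + 1) / ln x \<le> (a + 1) * ?m\<^sub>2 / ln x"
        proof (intro divide_right_mono)
          have "(a + 1) * \<epsilon> \<le> (a + 1) * ?m\<^sub>2"
            using assms \<epsilon> by (intro mult_left_mono) auto
          then show "D + 1 \<le> (a + 1) * ?m\<^sub>2" using assms(3) by linarith
        qed (use elim in simp)
        then have "2 * x * ?m\<^sub>1 - ?m\<^sub>2 - (a + 1) * ?m\<^sub>2 / ln x + 2 * G / (a * x) \<le> 0"
          using drift elim(1) unfolding add_divide_distrib by linarith
        moreover have "0 \<le> q" unfolding q_def using assms elim by simp
        ultimately show ?thesis by (intro add_left_mono mult_left_mono) auto
      qed
      finally show "?E (lyapunov a) \<le> lyapunov a x" by simp
    qed
  qed
qed

section \<open>The Markov property\<close>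

locale countable_chain =
  fixes M :: "'a measure" and F :: "nat \<Rightarrow> 'a measure" and X :: "nat \<Rightarrow> 'a \<Rightarrow> real"
    and S :: "real set" and K :: "real \<Rightarrow> real pmf" and s :: "nat \<Rightarrow> real"
  assumes chain: "markov_chain M F S K X"
    and inj_s: "inj s" and range_s: "range s = S"
begin

sublocale prob_space M
  using chain unfolding markov_chain_def by blast

lemma state: "\<omega> \<in> space M \<Longrightarrow> X n \<omega> \<in> S"
  using chain unfolding markov_chain_def by blast

lemma kernel_closed: "x \<in> S \<Longrightarrow> y \<in> set_pmf (K x) \<Longrightarrow> y \<in> S"
  using chain unfolding markov_chain_def by blast

lemma subalg: "subalgebra M (F n)"
  using chain unfolding markov_chain_def by blast

lemma space_F [simp]: "space (F n) = space M"
  using subalg unfolding subalgebra_def by blast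

lemma sets_F: "A \<in> sets (F n) \<Longrightarrow> A \<in> sets M"
  using subalg unfolding subalgebra_def by blast

lemma sets_F_mono: "m \<le> n \<Longrightarrow> A \<in> sets (F m) \<Longrightarrow> A \<in> sets (F n)"
  using chain unfolding markov_chain_def filtration_def by blast

lemma countable_S: "countable S"
  using range_s by (metis countable_image countableI_type)

text \<open>The state space is countable, so \<open>P\<close> may be an arbitrary predicate: its
  event is a countable union of the events that \<open>X m\<close> has a given value.\<close>

lemma event_F [measurable]: "m \<le> n \<Longrightarrow> {\<omega> \<in> space M. P (X m \<omega>)} \<in> sets (F n)"
proof -
  assume "m \<le> n"
  have X: "X m \<in> borel_measurable (F m)"
    using chain unfolding markov_chain_def by blast
  have "{\<omega> \<in> space M. P (X m \<omega>)} = (\<Union>y\<in>{y \<in> S. P y}. {\<omega> \<in> space (F m). X m \<omega> = y})"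
    using state by auto
  also have "\<dots> \<in> sets (F m)"
  proof (rule sets.countable_UN'')
    show "countable {y \<in> S. P y}"
      by (rule countable_subset[OF _ countable_S]) auto
    show "{\<omega> \<in> space (F m). X m \<omega> = y} \<in> sets (F m)" for y
      using X by measurable
  qed
  finally show ?thesis using sets_F_mono[OF \<open>m \<le> n\<close>] by blast
qed

lemma all_le_F: "n \<le> k \<Longrightarrow> {\<omega> \<in> space M. \<forall>j\<le>n. P j (X j \<omega>)} \<in> sets (F k)"
proof -
  assume "n \<le> k"
  then have "(\<Union>j\<le>n. {\<omega> \<in> space M. \<not> P j (X j \<omega>)}) \<in> sets (F k)"
    by (intro sets.finite_UN event_F) auto
  then have "space (F k) - (\<Union>j\<le>n. {\<omega> \<in> space M. \<not> P j (X j \<omega>)}) \<in> sets (F k)"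
    by (rule sets.compl_sets)
  also have "space (F k) - (\<Union>j\<le>n. {\<omega> \<in> space M. \<not> P j (X j \<omega>)}) =
      {\<omega> \<in> space M. \<forall>j\<le>n. P j (X j \<omega>)}"
    by auto
  finally show ?thesis .
qed

lemma event [measurable]: "{\<omega> \<in> space M. P (X m \<omega>)} \<in> sets M"
  by (rule sets_F[OF event_F[OF order_refl]])

lemma pred_X [measurable]: "Measurable.pred M (\<lambda>\<omega>. P (X m \<omega>))"
  unfolding pred_def by (rule event)

lemma measurable_comp_X [measurable]: "(\<lambda>\<omega>. h (X n \<omega>)) \<in> borel_measurable M"
  for h :: "real \<Rightarrow> 'b :: topological_space"
proof (rule measurableI)
  fix A assume "A \<in> sets (borel :: 'b measure)"
  have "(\<lambda>\<omega>. h (X n \<omega>)) -` A \<inter> space M = {\<omega> \<in> space M. h (X n \<omega>) \<in> A}"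
    by auto
  then show "(\<lambda>\<omega>. h (X n \<omega>)) -` A \<inter> space M \<in> sets M"
    using event[of "\<lambda>x. h x \<in> A"] by simp
qed simp

lemma markov_singleton:
  assumes A: "A \<in> sets (F n)" and y: "y \<in> S"
  shows "emeasure M (A \<inter> {\<omega> \<in> space M. X (Suc n) \<omega> = y}) =
    (\<integral>\<^sup>+\<omega>. indicator A \<omega> * ennreal (pmf (K (X n \<omega>)) y) \<partial>M)"
proof -
  interpret sub: finite_measure_subalgebra M "F n"
    by unfold_locales (rule subalg)
  let ?f = "\<lambda>\<omega>. indicator {y} (X (Suc n) \<omega>) :: real"
  have AM: "A \<in> sets M" by (rule sets_F[OF A])
  have f_eq: "?f \<omega> = indicator {\<omega> \<in> space M. X (Suc n) \<omega> = y} \<omega>" if "\<omega> \<in> space M" for \<omega>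
    using that by (auto simp: indicator_def)
  have int: "integrable M ?f"
    by (subst Bochner_Integration.integrable_cong[OF refl f_eq])
       (auto intro: integrable_real_indicator simp: emeasure_eq_measure event)
  have meas: "(\<lambda>\<omega>. pmf (K (X n \<omega>)) y) \<in> borel_measurable M"
    by (rule measurable_comp_X)
  have "measure M (A \<inter> {\<omega> \<in> space M. X (Suc n) \<omega> = y}) = (\<integral>\<omega>\<in>A. ?f \<omega> \<partial>M)"
    unfolding set_lebesgue_integral_def
    by (subst Bochner_Integration.integral_cong[OF refl,
          where g = "indicator (A \<inter> {\<omega> \<in> space M. X (Suc n) \<omega> = y})"])
       (use AM sets.sets_into_space[OF AM] in \<open>auto simp: indicator_def event intro!: arg_cong[where f = "measure M"]\<close>)
  also have "\<dots> = (\<integral>\<omega>\<in>A. real_cond_exp M (F n) ?f \<omega> \<partial>M)"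
    by (rule sub.real_cond_exp_intA[OF int A])
  also have "\<dots> = (\<integral>\<omega>. indicator A \<omega> * pmf (K (X n \<omega>)) y \<partial>M)"
  proof -
    have "AE \<omega> in M. real_cond_exp M (F n) ?f \<omega> = pmf (K (X n \<omega>)) y"
      using chain y unfolding markov_chain_def by blast
    then show ?thesis
      unfolding set_lebesgue_integral_def using AM meas
      by (intro integral_cong_AE) auto
  qed
  finally have *: "measure M (A \<inter> {\<omega> \<in> space M. X (Suc n) \<omega> = y}) =
    (\<integral>\<omega>. indicator A \<omega> * pmf (K (X n \<omega>)) y \<partial>M)" .
  have "(\<integral>\<^sup>+\<omega>. indicator A \<omega> * ennreal (pmf (K (X n \<omega>)) y) \<partial>M) =
      (\<integral>\<^sup>+\<omega>. ennreal (indicator A \<omega> * pmf (K (X n \<omega>)) y) \<partial>M)"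
    by (intro nn_integral_cong) (auto simp: indicator_def)
  also have "\<dots> = ennreal (\<integral>\<omega>. indicator A \<omega> * pmf (K (X n \<omega>)) y \<partial>M)"
    using AM meas
    by (intro nn_integral_eq_integral integrable_const_bound[where B = 1])
       (auto simp: indicator_def pmf_le_1)
  finally show ?thesis
    unfolding emeasure_eq_measure * by simp
qed

lemma suminf_indicator_state:
  "x \<in> S \<Longrightarrow> (\<Sum>k. h (s k) * indicator {s k} x) = (h x :: ennreal)"
  using range_s inj_s
  by (auto intro!: suminf_cmult_indicator[where A = "\<lambda>k. {s k}", THEN trans]
      simp: disjoint_family_on_def inj_eq)

text \<open>The assumed conditional probabilities concern single states. Writing \<open>h\<close> as
  a series of point indicators and exchanging sum and integral extends them to every nonnegative
  function.\<close>

lemma markov: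
  assumes A: "A \<in> sets (F n)"
  shows "(\<integral>\<^sup>+\<omega>. indicator A \<omega> * h (X (Suc n) \<omega>) \<partial>M) =
    (\<integral>\<^sup>+\<omega>. indicator A \<omega> * (\<integral>\<^sup>+y. h y \<partial>K (X n \<omega>)) \<partial>M)"
proof -
  have AM: "A \<in> sets M" by (rule sets_F[OF A])
  have "(\<integral>\<^sup>+\<omega>. indicator A \<omega> * h (X (Suc n) \<omega>) \<partial>M) =
      (\<integral>\<^sup>+\<omega>. (\<Sum>k. h (s k) * indicator (A \<inter> {\<omega> \<in> space M. X (Suc n) \<omega> = s k}) \<omega>) \<partial>M)"
  proof (rule nn_integral_cong)
    fix \<omega> assume \<omega>: "\<omega> \<in> space M"
    have "indicator A \<omega> * h (X (Suc n) \<omega>) =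
        (\<Sum>k. indicator A \<omega> * (h (s k) * indicator {s k} (X (Suc n) \<omega>)))"
      using suminf_indicator_state[OF state[OF \<omega>], of h "Suc n"] by simp
    also have "\<dots> = (\<Sum>k. h (s k) * indicator (A \<inter> {\<omega> \<in> space M. X (Suc n) \<omega> = s k}) \<omega>)"
      using \<omega> by (intro suminf_cong) (auto simp: indicator_def)
    finally show "indicator A \<omega> * h (X (Suc n) \<omega>) =
        (\<Sum>k. h (s k) * indicator (A \<inter> {\<omega> \<in> space M. X (Suc n) \<omega> = s k}) \<omega>)" .
  qed
  also have "\<dots> = (\<Sum>k. h (s k) * emeasure M (A \<inter> {\<omega> \<in> space M. X (Suc n) \<omega> = s k}))"
    using AM by (subst nn_integral_suminf) (auto simp: nn_integral_cmult_indicator event)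
  also have "\<dots> = (\<Sum>k. h (s k) * (\<integral>\<^sup>+\<omega>. indicator A \<omega> * ennreal (pmf (K (X n \<omega>)) (s k)) \<partial>M))"
    using range_s by (intro suminf_cong) (subst markov_singleton[OF A], auto)
  also have "\<dots> = (\<Sum>k. (\<integral>\<^sup>+\<omega>. h (s k) * (indicator A \<omega> * ennreal (pmf (K (X n \<omega>)) (s k))) \<partial>M))"
    using AM measurable_comp_X
    by (subst nn_integral_cmult) auto
  also have "\<dots> = (\<integral>\<^sup>+\<omega>. (\<Sum>k. h (s k) * (indicator A \<omega> * ennreal (pmf (K (X n \<omega>)) (s k)))) \<partial>M)"
    using AM measurable_comp_X
    by (subst nn_integral_suminf) auto
  also have "\<dots> = (\<integral>\<^sup>+\<omega>. indicator A \<omega> * (\<integral>\<^sup>+y. h y \<partial>K (X n \<omega>)) \<partial>M)"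
  proof (rule nn_integral_cong)
    fix \<omega> assume \<omega>: "\<omega> \<in> space M"
    have "(\<integral>\<^sup>+y. h y \<partial>K (X n \<omega>)) = (\<integral>\<^sup>+y. (\<Sum>k. h (s k) * indicator {s k} y) \<partial>K (X n \<omega>))"
      using kernel_closed[OF state[OF \<omega>]] suminf_indicator_state
      by (intro nn_integral_cong_AE) (auto simp: AE_measure_pmf_iff)
    also have "\<dots> = (\<Sum>k. h (s k) * ennreal (pmf (K (X n \<omega>)) (s k)))"
      by (subst nn_integral_suminf) (auto simp: nn_integral_cmult_indicator emeasure_pmf_single)
    finally have "indicator A \<omega> * (\<integral>\<^sup>+y. h y \<partial>K (X n \<omega>)) =
        (\<Sum>k. indicator A \<omega> * (h (s k) * ennreal (pmf (K (X n \<omega>)) (s k))))"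
      by simp
    then show "(\<Sum>k. h (s k) * (indicator A \<omega> * ennreal (pmf (K (X n \<omega>)) (s k)))) =
        indicator A \<omega> * (\<integral>\<^sup>+y. h y \<partial>K (X n \<omega>))"
      by (simp add: mult_ac)
  qed
  finally show ?thesis .
qed

lemma transition_prob:
  assumes "y \<in> S"
  shows "emeasure M {\<omega> \<in> space M. X n \<omega> = x \<and> X (Suc n) \<omega> = y} =
    emeasure M {\<omega> \<in> space M. X n \<omega> = x} * ennreal (pmf (K x) y)"
proof -
  let ?A = "{\<omega> \<in> space M. X n \<omega> = x}"
  have "emeasure M {\<omega> \<in> space M. X n \<omega> = x \<and> X (Suc n) \<omega> = y} =
      emeasure M (?A \<inter> {\<omega> \<in> space M. X (Suc n) \<omega> = y})"
    by (rule arg_cong[where f = "emeasure M"]) auto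
  also have "\<dots> = (\<integral>\<^sup>+\<omega>. indicator ?A \<omega> * ennreal (pmf (K (X n \<omega>)) y) \<partial>M)"
    by (rule markov_singleton[OF event_F[OF order_refl] assms])
  also have "\<dots> = (\<integral>\<^sup>+\<omega>. ennreal (pmf (K x) y) * indicator ?A \<omega> \<partial>M)"
    by (intro nn_integral_cong) (auto simp: indicator_def)
  also have "\<dots> = emeasure M ?A * ennreal (pmf (K x) y)"
    by (simp add: nn_integral_cmult_indicator event mult.commute)
  finally show ?thesis .
qed

text \<open>The almost sure bound on the increments of \<open>X\<close> says something about
  \<open>K x\<close> only if \<open>x\<close> is visited with positive probability. Some state is
  charged by \<open>X 0\<close>, and positive probability propagates along possible steps;
  \<open>kernel_jump\<close> relies on this.\<close>

lemma visited:
  assumes reach: "\<And>x. x \<in> S \<Longrightarrow> (x, y) \<in> {(a, b). b \<in> set_pmf (K a)}\<^sup>*"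
  shows "\<exists>n. emeasure M {\<omega> \<in> space M. X n \<omega> = y} > 0"
proof -
  have "\<exists>x\<in>S. emeasure M {\<omega> \<in> space M. X 0 \<omega> = x} > 0"
  proof (rule ccontr)
    assume "\<not> ?thesis"
    then have "AE \<omega> in M. X 0 \<omega> \<noteq> x" if "x \<in> S" for x
      using that by (subst AE_iff_measurable[OF event refl]) (auto simp: event)
    then have "AE \<omega> in M. \<forall>x\<in>S. X 0 \<omega> \<noteq> x"
      by (subst AE_ball_countable[OF countable_S]) auto
    moreover have "AE \<omega> in M. X 0 \<omega> \<in> S"
      using state by auto
    ultimately have "AE \<omega> in M. False" by eventually_elim auto
    then show False by simp
  qed
  then obtain x where x: "x \<in> S" "emeasure M {\<omega> \<in> space M. X 0 \<omega> = x} > 0" by blast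
  from reach[OF x(1)]
  have "y \<in> S \<and> (\<exists>n. emeasure M {\<omega> \<in> space M. X n \<omega> = y} > 0)"
  proof (induction rule: rtrancl_induct)
    case base
    then show ?case using x by blast
  next
    case (step u v)
    then obtain n where n: "u \<in> S" "v \<in> set_pmf (K u)" "emeasure M {\<omega> \<in> space M. X n \<omega> = u} > 0"
      by auto
    then have v: "v \<in> S" using kernel_closed by blast
    have "0 < emeasure M {\<omega> \<in> space M. X n \<omega> = u} * ennreal (pmf (K u) v)"
      using n by (simp add: ennreal_zero_less_mult_iff pmf_positive)
    also have "\<dots> = emeasure M {\<omega> \<in> space M. X n \<omega> = u \<and> X (Suc n) \<omega> = v}"
      by (rule transition_prob[OF v, symmetric])
    also have "\<dots> \<le> emeasure M {\<omega> \<in> space M. X (Suc n) \<omega> = v}"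
      by (intro emeasure_mono event) auto
    finally show ?case using v by blast
  qed
  then show ?thesis by blast
qed

lemma kernel_jump:
  assumes reach: "\<And>u. u \<in> S \<Longrightarrow> (u, x) \<in> {(a, b). b \<in> set_pmf (K a)}\<^sup>*"
    and bounded: "\<And>n. AE \<omega> in M. \<bar>X (Suc n) \<omega> - X n \<omega>\<bar> \<le> B"
    and x: "x \<in> S" "y \<in> set_pmf (K x)"
  shows "\<bar>y - x\<bar> \<le> B"
proof (rule ccontr)
  assume far: "\<not> \<bar>y - x\<bar> \<le> B"
  obtain n where n: "emeasure M {\<omega> \<in> space M. X n \<omega> = x} > 0"
    using visited[OF reach] by blast
  have "AE \<omega> in M. \<not> (X n \<omega> = x \<and> X (Suc n) \<omega> = y)"
    using bounded[of n] by eventually_elim (use far in auto)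
  then have "emeasure M {\<omega> \<in> space M. X n \<omega> = x \<and> X (Suc n) \<omega> = y} = 0"
    by (subst (asm) AE_iff_measurable[OF _ refl]) auto
  then show False
    using transition_prob[OF kernel_closed[OF x], of n x] n x(2)
    by (auto simp: pmf_positive_iff set_pmf_iff)
qed

end

section \<open>Path events expressed through escape and hitting probabilities\<close>

locale bounded_chain = countable_chain M F X S K s + bounded_kernel S K B
  for M :: "'a measure" and F X S K s B +
  assumes bounded_increments: "AE \<omega> in M. \<bar>X (Suc n) \<omega> - X n \<omega>\<bar> \<le> B"
    and state_nonneg: "x \<in> S \<Longrightarrow> 0 \<le> x"
begin

lemma nn_integral_kernel:
  assumes "x \<in> S" "\<And>y. y \<in> S \<Longrightarrow> 0 \<le> h y"
  shows "(\<integral>\<^sup>+y. ennreal (h y) \<partial>K x) = ennreal (avg h x)"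
  using assms closed
  by (intro nn_integral_eq_integral integrable_kernel) (auto simp: AE_measure_pmf_iff)

lemma markov_avg:
  assumes A: "A \<in> sets (F n)" and h: "\<And>y. y \<in> S \<Longrightarrow> 0 \<le> h y"
  shows "(\<integral>\<^sup>+\<omega>. indicator A \<omega> * ennreal (h (X (Suc n) \<omega>)) \<partial>M) =
    (\<integral>\<^sup>+\<omega>. indicator A \<omega> * ennreal (avg h (X n \<omega>)) \<partial>M)"
  unfolding markov[OF A, of "\<lambda>y. ennreal (h y)"]
  by (intro nn_integral_cong) (simp add: nn_integral_kernel state h)

lemma measurable_indicator_comp_X:
  "A \<in> sets M \<Longrightarrow> (\<lambda>\<omega>. indicator A \<omega> * ennreal (h (X n \<omega>))) \<in> borel_measurable M"
  by (intro borel_measurable_times_ennreal borel_measurable_indicator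
      measurable_comp_X[of "\<lambda>x. ennreal (h x)"])

text \<open>\<open>survival x m\<close> checks the \<open>m + 1\<close> times from \<open>n\<close>
  to \<open>n + m\<close>, since \<open>survival x 0\<close> already checks the present
  state.\<close>

lemma stay:
  assumes "A \<in> sets (F n)"
  shows "emeasure M (A \<inter> {\<omega> \<in> space M. \<forall>j\<in>{n..n + m}. x < X j \<omega>}) =
    (\<integral>\<^sup>+\<omega>. indicator A \<omega> * ennreal (survival x m (X n \<omega>)) \<partial>M)"
  using assms
proof (induction m arbitrary: n A)
  case 0
  have "A \<in> sets M" by (rule sets_F[OF 0])
  then have "emeasure M (A \<inter> {\<omega> \<in> space M. x < X n \<omega>}) =
      (\<integral>\<^sup>+\<omega>. indicator (A \<inter> {\<omega> \<in> space M. x < X n \<omega>}) \<omega> \<partial>M)"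
    by (simp add: event)
  also have "\<dots> = (\<integral>\<^sup>+\<omega>. indicator A \<omega> * ennreal (survival x 0 (X n \<omega>)) \<partial>M)"
    by (intro nn_integral_cong) (auto simp: indicator_def)
  finally show ?case by simp
next
  case (Suc m)
  let ?A = "A \<inter> {\<omega> \<in> space M. x < X n \<omega>}"
  have A': "?A \<in> sets (F n)"
    using Suc.prems event_F[OF order_refl] by (rule sets.Int)
  have "A \<inter> {\<omega> \<in> space M. \<forall>j\<in>{n..n + Suc m}. x < X j \<omega>} =
      ?A \<inter> {\<omega> \<in> space M. \<forall>j\<in>{Suc n..Suc n + m}. x < X j \<omega>}"
    by (auto simp: not_less_eq_eq le_less_Suc_eq dest: le_antisym)
  then have "emeasure M (A \<inter> {\<omega> \<in> space M. \<forall>j\<in>{n..n + Suc m}. x < X j \<omega>}) =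
      emeasure M (?A \<inter> {\<omega> \<in> space M. \<forall>j\<in>{Suc n..Suc n + m}. x < X j \<omega>})"
    by simp
  also have "\<dots> = (\<integral>\<^sup>+\<omega>. indicator ?A \<omega> * ennreal (survival x m (X (Suc n) \<omega>)) \<partial>M)"
    by (rule Suc.IH[OF sets_F_mono[OF _ A']]) simp
  also have "\<dots> = (\<integral>\<^sup>+\<omega>. indicator ?A \<omega> * ennreal (avg (survival x m) (X n \<omega>)) \<partial>M)"
    by (rule markov_avg[OF A']) (use survival_bounds in blast)
  also have "\<dots> = (\<integral>\<^sup>+\<omega>. indicator A \<omega> * ennreal (survival x (Suc m) (X n \<omega>)) \<partial>M)"
    by (intro nn_integral_cong) (auto simp: indicator_def)
  finally show ?case .
qed

lemma stay_forever:
  assumes A: "A \<in> sets (F n)"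
  shows "emeasure M (A \<inter> {\<omega> \<in> space M. \<forall>j\<ge>n. x < X j \<omega>}) =
    (\<integral>\<^sup>+\<omega>. indicator A \<omega> * ennreal (escape x (X n \<omega>)) \<partial>M)"
proof (rule LIMSEQ_unique)
  have AM: "A \<in> sets M" by (rule sets_F[OF A])
  let ?E = "\<lambda>m. A \<inter> {\<omega> \<in> space M. \<forall>j\<in>{n..n + m}. x < X j \<omega>}"
  have "(\<lambda>m. emeasure M (?E m)) \<longlonglongrightarrow> emeasure M (\<Inter>m. ?E m)"
    using AM by (intro Lim_emeasure_decseq) (auto simp: decseq_def)
  also have "(\<Inter>m. ?E m) = A \<inter> {\<omega> \<in> space M. \<forall>j\<ge>n. x < X j \<omega>}"
  proof (intro equalityI subsetI)
    fix \<omega> assume \<omega>: "\<omega> \<in> (\<Inter>m. ?E m)"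
    have "x < X j \<omega>" if "n \<le> j" for j
      using \<omega> that by (auto dest!: spec[of _ "j - n"])
    then show "\<omega> \<in> A \<inter> {\<omega> \<in> space M. \<forall>j\<ge>n. x < X j \<omega>}"
      using \<omega> by auto
  qed auto
  finally show "(\<lambda>m. emeasure M (?E m)) \<longlonglongrightarrow> emeasure M (A \<inter> {\<omega> \<in> space M. \<forall>j\<ge>n. x < X j \<omega>})" .
  show "(\<lambda>m. emeasure M (?E m)) \<longlonglongrightarrow> (\<integral>\<^sup>+\<omega>. indicator A \<omega> * ennreal (escape x (X n \<omega>)) \<partial>M)"
    unfolding stay[OF A]
  proof (rule nn_integral_dominated_convergence[where w = "\<lambda>_. 1"])
    show "AE \<omega> in M. (\<lambda>m. indicator A \<omega> * ennreal (survival x m (X n \<omega>)))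
        \<longlonglongrightarrow> indicator A \<omega> * ennreal (escape x (X n \<omega>))"
      by (intro AE_I2) (auto simp: indicator_def intro!: tendsto_ennrealI survival_tendsto state)
    show "AE \<omega> in M. indicator A \<omega> * ennreal (survival x m (X n \<omega>)) \<le> 1" for m
      using survival_bounds[OF state] by (intro AE_I2) (auto simp: indicator_def)
  qed (auto intro: measurable_indicator_comp_X[OF AM] simp: emeasure_space_1)
qed

lemma escape_from:
  assumes A: "A \<in> sets (F n)" "\<And>\<omega>. \<omega> \<in> A \<Longrightarrow> X n \<omega> = x"
  shows "emeasure M (A \<inter> {\<omega> \<in> space M. \<forall>j>n. z < X j \<omega>}) = emeasure M A * ennreal (avg (escape z) x)"
proof -
  have AM: "A \<in> sets M" by (rule sets_F[OF A(1)])
  have "emeasure M (A \<inter> {\<omega> \<in> space M. \<forall>j>n. z < X j \<omega>}) =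
      emeasure M (A \<inter> {\<omega> \<in> space M. \<forall>j\<ge>Suc n. z < X j \<omega>})"
    by (simp add: Suc_le_eq)
  also have "\<dots> = (\<integral>\<^sup>+\<omega>. indicator A \<omega> * ennreal (escape z (X (Suc n) \<omega>)) \<partial>M)"
    by (rule stay_forever[OF sets_F_mono[OF _ A(1)]]) simp
  also have "\<dots> = (\<integral>\<^sup>+\<omega>. indicator A \<omega> * ennreal (avg (escape z) (X n \<omega>)) \<partial>M)"
    by (rule markov_avg[OF A(1)]) (rule escape_bounds)
  also have "\<dots> = (\<integral>\<^sup>+\<omega>. ennreal (avg (escape z) x) * indicator A \<omega> \<partial>M)"
    by (intro nn_integral_cong) (auto simp: indicator_def A(2))
  also have "\<dots> = emeasure M A * ennreal (avg (escape z) x)"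
    using AM by (simp add: nn_integral_cmult_indicator) (rule mult.commute)
  finally show ?thesis .
qed

text \<open>The strong Markov property at the first visit to \<open>z\<close>, obtained by induction
  on the horizon \<open>k\<close>: either the chain is at \<open>z\<close> now and must escape, or
  it is strictly between \<open>x\<close> and \<open>z\<close> and the event is shifted by one time
  step.\<close>

lemma hit_then_escape:
  assumes "A \<in> sets (F n)" and "x < z"
  shows "emeasure M (A \<inter> {\<omega> \<in> space M. \<exists>m\<le>k. (\<forall>j\<in>{n..<n + m}. x < X j \<omega> \<and> X j \<omega> < z) \<and>
      X (n + m) \<omega> = z \<and> (\<forall>j>n + m. z < X j \<omega>)}) =
    (\<integral>\<^sup>+\<omega>. indicator A \<omega> * ennreal (hitting x z k (X n \<omega>)) \<partial>M) * ennreal (avg (escape z) z)"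
  using assms(1)
proof (induction k arbitrary: n A)
  case (0 n A)
  let ?A = "A \<inter> {\<omega> \<in> space M. X n \<omega> = z}"
  have A': "?A \<in> sets (F n)"
    using 0 event_F[OF order_refl] by (rule sets.Int)
  have "emeasure M (?A \<inter> {\<omega> \<in> space M. \<forall>j>n. z < X j \<omega>}) = emeasure M ?A * ennreal (avg (escape z) z)"
    by (rule escape_from[OF A']) auto
  also have "emeasure M ?A = (\<integral>\<^sup>+\<omega>. indicator ?A \<omega> \<partial>M)"
    using sets_F[OF A'] by simp
  also have "\<dots> = (\<integral>\<^sup>+\<omega>. indicator A \<omega> * ennreal (hitting x z 0 (X n \<omega>)) \<partial>M)"
    by (intro nn_integral_cong) (auto simp: indicator_def)
  finally have "emeasure M (?A \<inter> {\<omega> \<in> space M. \<forall>j>n. z < X j \<omega>}) =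
    (\<integral>\<^sup>+\<omega>. indicator A \<omega> * ennreal (hitting x z 0 (X n \<omega>)) \<partial>M) * ennreal (avg (escape z) z)" .
  moreover have "?A \<inter> {\<omega> \<in> space M. \<forall>j>n. z < X j \<omega>} =
      A \<inter> {\<omega> \<in> space M. \<exists>m\<le>0. (\<forall>j\<in>{n..<n + m}. x < X j \<omega> \<and> X j \<omega> < z) \<and>
      X (n + m) \<omega> = z \<and> (\<forall>j>n + m. z < X j \<omega>)}"
    by auto
  ultimately show ?case by simp
next
  case (Suc k n A)
  define R where "R n k = {\<omega> \<in> space M. \<exists>m\<le>k. (\<forall>j\<in>{n..<n + m}. x < X j \<omega> \<and> X j \<omega> < z) \<and>
      X (n + m) \<omega> = z \<and> (\<forall>j>n + m. z < X j \<omega>)}" for n k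
  have R: "R n k \<in> sets M" for n k
    unfolding R_def by measurable
  have R_Suc: "\<omega> \<in> R n (Suc k) \<longleftrightarrow> (X n \<omega> = z \<and> (\<forall>j>n. z < X j \<omega>)) \<or>
      (x < X n \<omega> \<and> X n \<omega> < z \<and> \<omega> \<in> R (Suc n) k)" if "\<omega> \<in> space M" for \<omega>
  proof
    assume "\<omega> \<in> R n (Suc k)"
    then obtain m where m: "m \<le> Suc k" "\<forall>j\<in>{n..<n + m}. x < X j \<omega> \<and> X j \<omega> < z"
        "X (n + m) \<omega> = z" "\<forall>j>n + m. z < X j \<omega>"
      unfolding R_def by blast
    show "(X n \<omega> = z \<and> (\<forall>j>n. z < X j \<omega>)) \<or> (x < X n \<omega> \<and> X n \<omega> < z \<and> \<omega> \<in> R (Suc n) k)"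
    proof (cases m)
      case 0
      then show ?thesis using m by simp
    next
      case (Suc m')
      then have "\<omega> \<in> R (Suc n) k"
        using m that unfolding R_def by (auto intro!: exI[of _ m'])
      moreover have "x < X n \<omega> \<and> X n \<omega> < z"
        using m(2) Suc by auto
      ultimately show ?thesis by simp
    qed
  next
    assume "(X n \<omega> = z \<and> (\<forall>j>n. z < X j \<omega>)) \<or> (x < X n \<omega> \<and> X n \<omega> < z \<and> \<omega> \<in> R (Suc n) k)"
    then show "\<omega> \<in> R n (Suc k)"
    proof
      assume "X n \<omega> = z \<and> (\<forall>j>n. z < X j \<omega>)"
      then show ?thesis
        using that unfolding R_def by (auto intro!: exI[of _ 0])
    next
      assume *: "x < X n \<omega> \<and> X n \<omega> < z \<and> \<omega> \<in> R (Suc n) k"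
      then obtain m where m: "m \<le> k" "\<forall>j\<in>{Suc n..<Suc n + m}. x < X j \<omega> \<and> X j \<omega> < z"
          "X (Suc n + m) \<omega> = z" "\<forall>j>Suc n + m. z < X j \<omega>"
        unfolding R_def by blast
      have "\<forall>j\<in>{n..<n + Suc m}. x < X j \<omega> \<and> X j \<omega> < z"
      proof
        fix j assume "j \<in> {n..<n + Suc m}"
        then show "x < X j \<omega> \<and> X j \<omega> < z"
          using * m(2) by (cases "j = n") auto
      qed
      then show ?thesis
        using that m unfolding R_def by (auto intro!: exI[of _ "Suc m"])
    qed
  qed
  let ?A = "A \<inter> {\<omega> \<in> space M. X n \<omega> = z}" and ?B = "A \<inter> {\<omega> \<in> space M. x < X n \<omega> \<and> X n \<omega> < z}"
  have AM: "A \<in> sets M" by (rule sets_F[OF Suc.prems])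
  have A': "?A \<in> sets (F n)" and B': "?B \<in> sets (F n)"
    using Suc.prems event_F[OF order_refl] by (rule sets.Int)+
  have "A \<inter> R n (Suc k) = (?A \<inter> {\<omega> \<in> space M. \<forall>j>n. z < X j \<omega>}) \<union> (?B \<inter> R (Suc n) k)"
    using sets.sets_into_space[OF AM] R_Suc by auto
  then have "emeasure M (A \<inter> R n (Suc k)) =
      emeasure M (?A \<inter> {\<omega> \<in> space M. \<forall>j>n. z < X j \<omega>}) + emeasure M (?B \<inter> R (Suc n) k)"
    using AM R by (simp only:) (rule plus_emeasure[symmetric], auto)
  also have "emeasure M (?A \<inter> {\<omega> \<in> space M. \<forall>j>n. z < X j \<omega>}) = emeasure M ?A * ennreal (avg (escape z) z)"
    by (rule escape_from[OF A']) auto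
  also have "emeasure M (?B \<inter> R (Suc n) k) =
      (\<integral>\<^sup>+\<omega>. indicator ?B \<omega> * ennreal (hitting x z k (X (Suc n) \<omega>)) \<partial>M) * ennreal (avg (escape z) z)"
    unfolding R_def by (rule Suc.IH[OF sets_F_mono[OF _ B']]) simp
  also have "(\<integral>\<^sup>+\<omega>. indicator ?B \<omega> * ennreal (hitting x z k (X (Suc n) \<omega>)) \<partial>M) =
      (\<integral>\<^sup>+\<omega>. indicator ?B \<omega> * ennreal (avg (hitting x z k) (X n \<omega>)) \<partial>M)"
    by (rule markov_avg[OF B']) (use hitting_bounds in blast)
  also have "emeasure M ?A * ennreal (avg (escape z) z) +
      (\<integral>\<^sup>+\<omega>. indicator ?B \<omega> * ennreal (avg (hitting x z k) (X n \<omega>)) \<partial>M) * ennreal (avg (escape z) z) =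
      (emeasure M ?A + (\<integral>\<^sup>+\<omega>. indicator ?B \<omega> * ennreal (avg (hitting x z k) (X n \<omega>)) \<partial>M))
        * ennreal (avg (escape z) z)"
    by (simp add: distrib_right)
  also have "emeasure M ?A = (\<integral>\<^sup>+\<omega>. indicator ?A \<omega> \<partial>M)"
    using sets_F[OF A'] by simp
  also have "(\<integral>\<^sup>+\<omega>. indicator ?A \<omega> \<partial>M) +
      (\<integral>\<^sup>+\<omega>. indicator ?B \<omega> * ennreal (avg (hitting x z k) (X n \<omega>)) \<partial>M) =
      (\<integral>\<^sup>+\<omega>. indicator ?A \<omega> + indicator ?B \<omega> * ennreal (avg (hitting x z k) (X n \<omega>)) \<partial>M)"
    by (intro nn_integral_add[symmetric] borel_measurable_indicator
        measurable_indicator_comp_X sets_F[OF A'] sets_F[OF B'])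
  also have "\<dots> = (\<integral>\<^sup>+\<omega>. indicator A \<omega> * ennreal (hitting x z (Suc k) (X n \<omega>)) \<partial>M)"
    by (intro nn_integral_cong) (auto simp: indicator_def)
  finally show ?case unfolding R_def .
qed

text \<open>The limit of \<open>hit_then_escape\<close> as the horizon grows, after one step away
  from \<open>x\<close>. Each finite-horizon event lies in the event on the right, which gives the
  inequality.\<close>

lemma hit_cutpoint:
  assumes A: "A \<in> sets (F n)" "\<And>\<omega>. \<omega> \<in> A \<Longrightarrow> X n \<omega> = x" and "x < z"
  shows "emeasure M A * ennreal (avg (hit x z) x * avg (escape z) z) \<le>
    emeasure M (A \<inter> {\<omega> \<in> space M. \<exists>m. (\<forall>j\<in>{Suc n..<Suc n + m}. x < X j \<omega> \<and> X j \<omega> < z) \<and>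
      X (Suc n + m) \<omega> = z \<and> (\<forall>j>Suc n + m. z < X j \<omega>)})"
    (is "_ \<le> emeasure M (A \<inter> ?R)")
proof (cases "A = {}")
  case False
  have AM: "A \<in> sets M" by (rule sets_F[OF A(1)])
  then have x: "x \<in> S"
    using False A(2) state sets.sets_into_space[OF AM] by blast
  have "(\<integral>\<^sup>+\<omega>. indicator A \<omega> * ennreal (hitting x z k (X (Suc n) \<omega>)) \<partial>M) * ennreal (avg (escape z) z)
      \<le> emeasure M (A \<inter> ?R)" for k
  proof -
    have "A \<in> sets (F (Suc n))" by (rule sets_F_mono[OF _ A(1)]) simp
    from hit_then_escape[OF this \<open>x < z\<close>, of k, symmetric] show ?thesis
      using AM by (simp only:) (rule emeasure_mono, auto)
  qed
  moreover have "(\<lambda>k. (\<integral>\<^sup>+\<omega>. indicator A \<omega> * ennreal (hitting x z k (X (Suc n) \<omega>)) \<partial>M) * ennreal (avg (escape z) z))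
      \<longlonglongrightarrow> (\<integral>\<^sup>+\<omega>. indicator A \<omega> * ennreal (hit x z (X (Suc n) \<omega>)) \<partial>M) * ennreal (avg (escape z) z)"
    unfolding mult.commute[of _ "ennreal (avg (escape z) z)"]
  proof (intro ennreal_tendsto_cmult nn_integral_dominated_convergence[where w = "\<lambda>_. 1"])
    show "AE \<omega> in M. (\<lambda>k. indicator A \<omega> * ennreal (hitting x z k (X (Suc n) \<omega>)))
        \<longlonglongrightarrow> indicator A \<omega> * ennreal (hit x z (X (Suc n) \<omega>))"
      by (intro AE_I2) (auto simp: indicator_def intro!: tendsto_ennrealI hitting_tendsto state)
    show "AE \<omega> in M. indicator A \<omega> * ennreal (hitting x z k (X (Suc n) \<omega>)) \<le> 1" for k
      using hitting_bounds[OF state] by (intro AE_I2) (auto simp: indicator_def)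
  qed (auto intro: measurable_indicator_comp_X[OF AM] simp: emeasure_space_1)
  ultimately have "(\<integral>\<^sup>+\<omega>. indicator A \<omega> * ennreal (hit x z (X (Suc n) \<omega>)) \<partial>M) * ennreal (avg (escape z) z)
      \<le> emeasure M (A \<inter> ?R)"
    by (intro LIMSEQ_le_const2) auto
  also have "(\<integral>\<^sup>+\<omega>. indicator A \<omega> * ennreal (hit x z (X (Suc n) \<omega>)) \<partial>M) =
      (\<integral>\<^sup>+\<omega>. indicator A \<omega> * ennreal (avg (hit x z) (X n \<omega>)) \<partial>M)"
    by (rule markov_avg[OF A(1)]) (rule hit_bounds)
  also have "\<dots> = (\<integral>\<^sup>+\<omega>. ennreal (avg (hit x z) x) * indicator A \<omega> \<partial>M)"
    by (intro nn_integral_cong) (auto simp: indicator_def A(2))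
  also have "\<dots> = emeasure M A * ennreal (avg (hit x z) x)"
    using AM by (simp add: nn_integral_cmult_indicator) (rule mult.commute)
  finally show ?thesis
    using avg_mono[of x "\<lambda>_. 0" "hit x z"] hit_bounds x by (simp add: ennreal_mult' mult.assoc)
qed simp

section \<open>Probabilities of cutpoint events\<close>

abbreviation trajectory :: "'a \<Rightarrow> nat \<Rightarrow> real" where
  "trajectory \<omega> \<equiv> \<lambda>n. X n \<omega>"

lemma cutpoint_event [measurable]: "{\<omega> \<in> space M. z \<in> cutpoints (trajectory \<omega>)} \<in> sets M"
  unfolding cutpoints_def mem_Collect_eq by measurable

lemma finite_cutpoints_event [measurable]: "{\<omega> \<in> space M. finite (cutpoints (trajectory \<omega>))} \<in> sets M"
proof -
  have "finite (cutpoints (trajectory \<omega>)) \<longleftrightarrow> (\<exists>k. \<forall>j\<ge>k. s j \<notin> cutpoints (trajectory \<omega>))" if "\<omega> \<in> space M" for \<omega>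
  proof -
    have "cutpoints (trajectory \<omega>) \<subseteq> range s"
      unfolding range_s cutpoints_def using state[OF that] by auto
    then have "cutpoints (trajectory \<omega>) = s ` {j. s j \<in> cutpoints (trajectory \<omega>)}"
      by auto
    then have "finite (cutpoints (trajectory \<omega>)) \<longleftrightarrow> finite {j. s j \<in> cutpoints (trajectory \<omega>)}"
      using finite_image_iff[of s "{j. s j \<in> cutpoints (trajectory \<omega>)}"] inj_s
      by (metis inj_on_subset subset_UNIV)
    also have "\<dots> \<longleftrightarrow> (\<exists>k. \<forall>j\<ge>k. s j \<notin> cutpoints (trajectory \<omega>))"
      unfolding finite_nat_set_iff_bounded by (meson linorder_not_le mem_Collect_eq)
    finally show ?thesis .
  qed
  then have "{\<omega> \<in> space M. finite (cutpoints (trajectory \<omega>))} =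
      {\<omega> \<in> space M. \<exists>k. \<forall>j\<ge>k. s j \<notin> cutpoints (trajectory \<omega>)}"
    by (intro Collect_cong conj_cong refl)
  also have "\<dots> \<in> sets M"
    by measurable
  finally show ?thesis .
qed

text \<open>A cutpoint \<open>z\<close> requires that the chain never returns after its first
  passage above \<open>z\<close>. Bounded jumps make it land at most at \<open>z + B\<close>, where
  the escape probability is at most \<open>b\<close>, and the possible passage times give disjoint
  events.\<close>

lemma cutpoint_prob_le:
  assumes b: "0 \<le> b" "\<And>y. y \<in> S \<Longrightarrow> y \<le> z + B \<Longrightarrow> escape z y \<le> b"
  shows "emeasure M {\<omega> \<in> space M. z \<in> cutpoints (trajectory \<omega>)} \<le> ennreal b"
proof -
  define A where "A n = {\<omega> \<in> space M. \<forall>j\<le>n. X j \<omega> \<le> z} \<inter> {\<omega> \<in> space M. z < X (Suc n) \<omega>}" for n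
  have AF: "A n \<in> sets (F (Suc n))" for n
    unfolding A_def by (intro sets.Int event_F[OF order_refl] all_le_F) simp
  have AM: "A n \<in> sets M" for n by (rule sets_F[OF AF])
  have disj: "disjoint_family A"
    unfolding disjoint_family_on_def
  proof (intro ballI impI)
    have *: "A m \<inter> A n = {}" if "m < n" for m n
    proof (intro equals0I, elim IntE)
      fix \<omega> assume "\<omega> \<in> A m" "\<omega> \<in> A n"
      then have "z < X (Suc m) \<omega>" "X (Suc m) \<omega> \<le> z"
        unfolding A_def using that by auto
      then show False by simp
    qed
    fix m n :: nat assume "m \<noteq> n"
    then show "A m \<inter> A n = {}"
      using *[of m n] *[of n m] by (cases m n rule: linorder_cases) auto
  qed
  have piece: "emeasure M (A n \<inter> {\<omega> \<in> space M. \<forall>j\<ge>Suc n. z < X j \<omega>}) \<le> ennreal b * emeasure M (A n)" for n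
  proof -
    have "emeasure M (A n \<inter> {\<omega> \<in> space M. \<forall>j\<ge>Suc n. z < X j \<omega>}) =
        (\<integral>\<^sup>+\<omega>. indicator (A n) \<omega> * ennreal (escape z (X (Suc n) \<omega>)) \<partial>M)"
      by (rule stay_forever[OF AF])
    also have "\<dots> \<le> (\<integral>\<^sup>+\<omega>. ennreal b * indicator (A n) \<omega> \<partial>M)"
    proof (rule nn_integral_mono_AE)
      show "AE \<omega> in M. indicator (A n) \<omega> * ennreal (escape z (X (Suc n) \<omega>)) \<le> ennreal b * indicator (A n) \<omega>"
        using bounded_increments[of n] AE_space
      proof eventually_elim
        case (elim \<omega>)
        show ?case
        proof (cases "\<omega> \<in> A n")
          case True
          then have "X n \<omega> \<le> z" unfolding A_def by auto
          then have "escape z (X (Suc n) \<omega>) \<le> b"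
            using elim by (intro b state) auto
          then show ?thesis using True by (simp add: ennreal_leI)
        qed simp
      qed
    qed
    also have "\<dots> = ennreal b * emeasure M (A n)"
      using AM by (simp add: nn_integral_cmult_indicator)
    finally show ?thesis .
  qed
  have "emeasure M {\<omega> \<in> space M. z \<in> cutpoints (trajectory \<omega>)} \<le>
      emeasure M (\<Union>n. A n \<inter> {\<omega> \<in> space M. \<forall>j\<ge>Suc n. z < X j \<omega>})"
  proof (intro emeasure_mono subsetI)
    fix \<omega> assume "\<omega> \<in> {\<omega> \<in> space M. z \<in> cutpoints (trajectory \<omega>)}"
    then obtain n where n: "\<omega> \<in> space M" "\<forall>j\<le>n. X j \<omega> \<le> z" "\<forall>j>n. z < X j \<omega>"
      unfolding cutpoints_def by auto
    then have "\<omega> \<in> A n \<inter> {\<omega> \<in> space M. \<forall>j\<ge>Suc n. z < X j \<omega>}"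
      unfolding A_def by auto
    then show "\<omega> \<in> (\<Union>n. A n \<inter> {\<omega> \<in> space M. \<forall>j\<ge>Suc n. z < X j \<omega>})"
      by blast
  qed (use AM in auto)
  also have "\<dots> \<le> (\<Sum>n. emeasure M (A n \<inter> {\<omega> \<in> space M. \<forall>j\<ge>Suc n. z < X j \<omega>}))"
    using AM by (intro emeasure_subadditive_countably) auto
  also have "\<dots> \<le> (\<Sum>n. ennreal b * emeasure M (A n))"
    by (intro suminf_le piece) auto
  also have "\<dots> = ennreal b * emeasure M (\<Union>n. A n)"
    using AM disj by (simp add: suminf_emeasure image_subset_iff)
  also have "\<dots> \<le> ennreal b * 1"
    by (intro mult_left_mono emeasure_le_1) auto
  finally show ?thesis by simp
qed


text \<open>A conditional first moment bound: the event of a cutpoint in \<open>I\<close> is split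
  by the lowest one, and each piece carries an expected number of at least \<kappa> cutpoints in
  \<open>J\<close>. In total this cannot exceed the expected number in \<open>J\<close>, which is at
  most \<open>card J * b\<close>.\<close>

lemma cutpoint_block_bound:
  fixes \<kappa> b :: real
  assumes I: "finite I" and J: "finite J"
    and \<kappa>: "0 \<le> \<kappa>" "\<And>x. x \<in> I \<Longrightarrow>
      \<kappa> * avg (escape x) x \<le> (\<Sum>z\<in>J \<inter> {x<..}. avg (hit x z) x * avg (escape z) z)"
    and IJ: "I \<subseteq> S" "J \<subseteq> S"
    and b: "0 \<le> b" "\<And>z y. z \<in> J \<Longrightarrow> y \<in> S \<Longrightarrow> y \<le> z + B \<Longrightarrow> escape z y \<le> b"
  shows "ennreal \<kappa> * emeasure M {\<omega> \<in> space M. \<exists>x\<in>I. x \<in> cutpoints (trajectory \<omega>)} \<le>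
    ennreal (real (card J) * b)"
proof -
  \<comment> \<open>\<open>G (n, x)\<close> is the event that \<open>x\<close> is the lowest cutpoint in \<open>I\<close> and is last visited at time
    \<open>n\<close>. Up to the event that the chain stays above \<open>x\<close> after time \<open>n\<close>, this only depends on the
    history \<open>A n x\<close> until time \<open>n\<close>.\<close>
  define past where "past n' n z \<omega> \<longleftrightarrow>
    X n' \<omega> = z \<and> (\<forall>j\<le>n'. X j \<omega> \<le> z) \<and> (\<forall>j\<le>n. n' < j \<longrightarrow> z < X j \<omega>)" for n' n z \<omega>
  \<comment> \<open>If the chain stays above \<open>x\<close> after time \<open>n\<close>, a lower
    state \<open>z\<close> is a cutpoint exactly when \<open>past\<close> holds for some
    \<open>n' < n\<close>. Removing these histories makes \<open>x\<close> the lowest cutpoint in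
    \<open>I\<close>.\<close>
  define A where "A n x = {\<omega> \<in> space M. X n \<omega> = x} \<inter> {\<omega> \<in> space M. \<forall>j\<le>n. X j \<omega> \<le> x} -
    (\<Union>z\<in>I \<inter> {..<x}. \<Union>n'<n. {\<omega> \<in> space M. past n' n z \<omega>})" for n x
  define G where "G = (\<lambda>(n, x). A n x \<inter> {\<omega> \<in> space M. \<forall>j>n. x < X j \<omega>})"
  let ?cut = "\<lambda>z. {\<omega> \<in> space M. z \<in> cutpoints (trajectory \<omega>)}"
  have past_F: "{\<omega> \<in> space M. past n' n z \<omega>} \<in> sets (F n)" if "n' < n" for n' n z
  proof -
    have "{\<omega> \<in> space M. past n' n z \<omega>} =
        {\<omega> \<in> space M. X n' \<omega> = z} \<inter> {\<omega> \<in> space M. \<forall>j\<le>n'. X j \<omega> \<le> z} \<inter>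
        {\<omega> \<in> space M. \<forall>j\<le>n. n' < j \<longrightarrow> z < X j \<omega>}"
      unfolding past_def by blast
    also have "\<dots> \<in> sets (F n)"
      by (intro sets.Int event_F[OF less_imp_le[OF that]] all_le_F[OF less_imp_le[OF that]]
          all_le_F[OF order_refl, of n "\<lambda>j u. n' < j \<longrightarrow> z < u"])
    finally show ?thesis .
  qed
  have AF: "A n x \<in> sets (F n)" for n x
    unfolding A_def using I
    by (intro sets.Diff sets.Int sets.finite_UN past_F event_F[OF order_refl]
        all_le_F[OF order_refl]) auto
  have A_at: "X n \<omega> = x" if "\<omega> \<in> A n x" for n x \<omega>
    using that unfolding A_def by blast
  have A_le: "X j \<omega> \<le> x" if "\<omega> \<in> A n x" "j \<le> n" for n x \<omega> j
    using that unfolding A_def by blast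
  have GM: "G i \<in> sets M" for i
    unfolding G_def using sets_F[OF AF] by (cases i) auto
  have cover: "{\<omega> \<in> space M. \<exists>x\<in>I. x \<in> cutpoints (trajectory \<omega>)} \<subseteq> \<Union> (G ` (UNIV \<times> I))"
  proof
    fix \<omega> assume \<omega>: "\<omega> \<in> {\<omega> \<in> space M. \<exists>x\<in>I. x \<in> cutpoints (trajectory \<omega>)}"
    let ?C = "{x \<in> I. x \<in> cutpoints (trajectory \<omega>)}"
    define x where "x = Min ?C"
    have C: "finite ?C" "?C \<noteq> {}" using I \<omega> by auto
    then have x: "x \<in> ?C" unfolding x_def by (rule Min_in)
    then obtain n where n: "\<forall>j\<le>n. X j \<omega> \<le> x" "X n \<omega> = x" "\<forall>j>n. x < X j \<omega>"
      unfolding cutpoints_def by auto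
    have "\<not> past n' n z \<omega>" if z: "z \<in> I" "z < x" and "n' < n" for n' z
    proof
      assume past: "past n' n z \<omega>"
      have "z < X j \<omega>" if "n' < j" for j
      proof (cases "j \<le> n")
        case False
        then have "x < X j \<omega>" using n by simp
        then show ?thesis using z by simp
      qed (use past that in \<open>simp add: past_def\<close>)
      then have "z \<in> cutpoints (trajectory \<omega>)"
        using past z IJ(1) state_nonneg unfolding past_def cutpoints_def by blast
      then have "x \<le> z"
        unfolding x_def using z C by (intro Min_le) auto
      with z show False by simp
    qed
    then have "\<omega> \<in> A n x"
      unfolding A_def using n \<omega> by auto
    then have "\<omega> \<in> G (n, x)"
      unfolding G_def using n \<omega> by auto
    then show "\<omega> \<in> \<Union> (G ` (UNIV \<times> I))"
      using x by blast
  qed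
  \<comment> \<open>The maximum until time \<open>n\<close> is \<open>x\<close>, so
    \<open>x'\<close> is reached later, and at that time \<open>x\<close> already satisfies
    \<open>past\<close>, which \<open>A n' x'\<close> excludes.\<close>
  have lower_wins: False if "\<omega> \<in> G (n, x)" "\<omega> \<in> G (n', x')" "x \<in> I" "x < x'" for \<omega> n x n' x'
  proof -
    have \<omega>: "\<omega> \<in> A n x" "\<omega> \<in> A n' x'" "\<forall>j>n. x < X j \<omega>" "\<omega> \<in> space M"
      using that unfolding G_def by auto
    have "n < n'"
      using A_le[OF \<omega>(1), of n'] A_at[OF \<omega>(2)] \<open>x < x'\<close> by (cases "n < n'") auto
    moreover have "past n n' x \<omega>"
      unfolding past_def using A_at[OF \<omega>(1)] A_le[OF \<omega>(1)] \<omega>(3) by simp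
    ultimately show False
      using \<omega>(2,4) \<open>x \<in> I\<close> \<open>x < x'\<close> unfolding A_def by blast
  qed
  have same_time: False if "\<omega> \<in> G (n, x)" "\<omega> \<in> G (n', x)" "n < n'" for \<omega> n n' x
    using that A_at[of \<omega> n' x] unfolding G_def by auto
  have disj: "disjoint_family_on G (UNIV \<times> I)"
    unfolding disjoint_family_on_def
  proof (intro ballI impI equals0I, elim IntE)
    fix i i' \<omega> assume i: "i \<in> UNIV \<times> I" "i' \<in> UNIV \<times> I" "i \<noteq> i'" and \<omega>: "\<omega> \<in> G i" "\<omega> \<in> G i'"
    obtain n x n' x' where eq: "i = (n, x)" "i' = (n', x')" by (cases i, cases i')
    show False
    proof (cases x x' rule: linorder_cases)
      case equal
      then have "n < n' \<or> n' < n" using i eq by auto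
      then show False
        using same_time[of \<omega> n x n'] same_time[of \<omega> n' x n] \<omega> eq equal by blast
    qed (use lower_wins[of \<omega> n x n' x'] lower_wins[of \<omega> n' x' n x] i \<omega> eq in auto)
  qed
  have piece: "ennreal \<kappa> * emeasure M (G (n, x)) \<le> (\<Sum>z\<in>J. emeasure M (G (n, x) \<inter> ?cut z))"
    if x: "x \<in> I" for n x
  proof -
    let ?w = "\<lambda>z. avg (hit x z) x * avg (escape z) z"
    have xS: "x \<in> S" using x IJ by auto
    have w: "0 \<le> ?w z" if "z \<in> J" for z
      using that IJ avg_mono[OF xS, of "\<lambda>_. 0" "hit x z"] hit_bounds escape_nonneg_avg[of z z]
      by (intro mult_nonneg_nonneg) auto
    have "ennreal \<kappa> * emeasure M (G (n, x)) = emeasure M (A n x) * ennreal (\<kappa> * avg (escape x) x)"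
      unfolding G_def using escape_from[OF AF A_at] \<kappa>(1) by (simp add: ennreal_mult' mult_ac)
    also have "\<dots> \<le> emeasure M (A n x) * ennreal (\<Sum>z\<in>J \<inter> {x<..}. ?w z)"
      by (intro mult_left_mono ennreal_leI \<kappa>(2) x) simp
    also have "\<dots> = (\<Sum>z\<in>J \<inter> {x<..}. emeasure M (A n x) * ennreal (?w z))"
    proof -
      have "ennreal (\<Sum>z\<in>J \<inter> {x<..}. ?w z) = (\<Sum>z\<in>J \<inter> {x<..}. ennreal (?w z))"
        by (rule sum_ennreal[symmetric]) (use w in auto)
      then show ?thesis by (simp only: sum_distrib_left)
    qed
    also have "\<dots> \<le> (\<Sum>z\<in>J \<inter> {x<..}. emeasure M (G (n, x) \<inter> ?cut z))"
    proof (rule sum_mono)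
      fix z assume z: "z \<in> J \<inter> {x<..}"
      have "emeasure M (A n x) * ennreal (?w z) \<le> emeasure M (A n x \<inter> {\<omega> \<in> space M.
          \<exists>m. (\<forall>j\<in>{Suc n..<Suc n + m}. x < X j \<omega> \<and> X j \<omega> < z) \<and>
            X (Suc n + m) \<omega> = z \<and> (\<forall>j>Suc n + m. z < X j \<omega>)})"
        using z by (intro hit_cutpoint[OF AF A_at]) auto
      also have "\<dots> \<le> emeasure M (G (n, x) \<inter> ?cut z)"
      proof (rule emeasure_mono)
        show "G (n, x) \<inter> ?cut z \<in> sets M" using GM cutpoint_event by blast
        \<comment> \<open>After time \<open>n\<close> such a path is in \<open>(x, z)\<close> until
          it hits \<open>z\<close>, and above \<open>z\<close> afterwards. So it never returns to
          \<open>x\<close>, which gives \<open>G (n, x)\<close>, and \<open>z\<close> is a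
          cutpoint.\<close>
        show "A n x \<inter> {\<omega> \<in> space M.
          \<exists>m. (\<forall>j\<in>{Suc n..<Suc n + m}. x < X j \<omega> \<and> X j \<omega> < z) \<and>
            X (Suc n + m) \<omega> = z \<and> (\<forall>j>Suc n + m. z < X j \<omega>)} \<subseteq> G (n, x) \<inter> ?cut z"
        proof
          fix \<omega> assume \<omega>: "\<omega> \<in> A n x \<inter> {\<omega> \<in> space M.
            \<exists>m. (\<forall>j\<in>{Suc n..<Suc n + m}. x < X j \<omega> \<and> X j \<omega> < z) \<and>
              X (Suc n + m) \<omega> = z \<and> (\<forall>j>Suc n + m. z < X j \<omega>)}"
          then obtain m where m: "\<forall>j\<in>{Suc n..<Suc n + m}. x < X j \<omega> \<and> X j \<omega> < z"
              "X (Suc n + m) \<omega> = z" "\<forall>j>Suc n + m. z < X j \<omega>"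
            by auto
          have A: "\<omega> \<in> A n x" "\<omega> \<in> space M" "x < z" using \<omega> z by auto
          have after: "x < X j \<omega> \<and> (j \<le> Suc n + m \<longrightarrow> X j \<omega> \<le> z)" if "n < j" for j
          proof (cases j "Suc n + m" rule: linorder_cases)
            case less
            then have "x < X j \<omega> \<and> X j \<omega> < z" using m(1) that by simp
            then show ?thesis by simp
          next
            case greater
            then have "z < X j \<omega>" using m(3) by blast
            then show ?thesis using A greater by simp
          qed (use m(2) A in simp)
          have before: "X j \<omega> \<le> z" if "j \<le> Suc n + m" for j
            using after[of j] A_le[OF A(1), of j] A(3) that by (cases "n < j") auto
          have "z \<in> cutpoints (trajectory \<omega>)"
            using m(2,3) before z IJ(2) state_nonneg unfolding cutpoints_def by blast
          then show "\<omega> \<in> G (n, x) \<inter> ?cut z"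
            using A after unfolding G_def by simp
        qed
      qed
      finally show "emeasure M (A n x) * ennreal (?w z) \<le> emeasure M (G (n, x) \<inter> ?cut z)" .
    qed
    also have "\<dots> \<le> (\<Sum>z\<in>J. emeasure M (G (n, x) \<inter> ?cut z))"
      using J by (intro sum_mono2) auto
    finally show ?thesis .
  qed
  have countable: "countable ((UNIV :: nat set) \<times> I)"
    using I by (simp add: countable_finite)
  have "ennreal \<kappa> * emeasure M {\<omega> \<in> space M. \<exists>x\<in>I. x \<in> cutpoints (trajectory \<omega>)} \<le>
      ennreal \<kappa> * emeasure M (\<Union> (G ` (UNIV \<times> I)))"
    by (intro mult_left_mono emeasure_mono cover sets.countable_UN'' countable GM) simp
  also have "\<dots> = ennreal \<kappa> * (\<integral>\<^sup>+i. emeasure M (G i) \<partial>count_space (UNIV \<times> I))"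
    by (subst emeasure_UN_countable[OF GM countable disj]) simp
  also have "\<dots> = (\<integral>\<^sup>+i. ennreal \<kappa> * emeasure M (G i) \<partial>count_space (UNIV \<times> I))"
    by (rule nn_integral_cmult[symmetric]) simp
  also have "\<dots> \<le> (\<integral>\<^sup>+i. (\<Sum>z\<in>J. emeasure M (G i \<inter> ?cut z)) \<partial>count_space (UNIV \<times> I))"
    using piece by (intro nn_integral_mono) auto
  \<comment> \<open>After the exchange of sums, the disjointness of the pieces leaves for each
    \<open>z\<close> at most the probability that \<open>z\<close> is a cutpoint.\<close>
  also have "\<dots> = (\<Sum>z\<in>J. \<integral>\<^sup>+i. emeasure M (G i \<inter> ?cut z) \<partial>count_space (UNIV \<times> I))"
    by (rule nn_integral_sum) simp
  also have "\<dots> = (\<Sum>z\<in>J. emeasure M (\<Union>i\<in>UNIV \<times> I. G i \<inter> ?cut z))"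
  proof (rule sum.cong[OF refl])
    fix z
    have "disjoint_family_on (\<lambda>i. G i \<inter> ?cut z) (UNIV \<times> I)"
      using disj unfolding disjoint_family_on_def by blast
    then show "(\<integral>\<^sup>+i. emeasure M (G i \<inter> ?cut z) \<partial>count_space (UNIV \<times> I)) =
        emeasure M (\<Union>i\<in>UNIV \<times> I. G i \<inter> ?cut z)"
      by (intro emeasure_UN_countable[symmetric] countable sets.Int GM cutpoint_event)
  qed
  also have "\<dots> \<le> (\<Sum>z\<in>J. ennreal b)"
  proof (rule sum_mono)
    fix z assume z: "z \<in> J"
    have "emeasure M (\<Union>i\<in>UNIV \<times> I. G i \<inter> ?cut z) \<le> emeasure M (?cut z)"
      by (intro emeasure_mono cutpoint_event) auto
    also have "\<dots> \<le> ennreal b"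
      by (intro cutpoint_prob_le b(1) b(2)[OF z])
    finally show "emeasure M (\<Union>i\<in>UNIV \<times> I. G i \<inter> ?cut z) \<le> ennreal b" .
  qed
  also have "\<dots> = ennreal (real (card J) * b)"
    using b(1) by (simp add: ennreal_mult' ennreal_of_nat_eq_real_of_nat)
  finally show ?thesis .
qed

end

section \<open>Cutpoints in dyadic blocks\<close>

context lamperti_kernel
begin

text \<open>Each interval \<open>(x + i * B, x + (i + 1) * B]\<close> contains a state by
  \<open>gap\<close>, which contributes at least \<open>1 / ((i + 1) * B)\<close>.\<close>

lemma gap_sum:
  fixes i\<^sub>0 n :: nat
  assumes x: "r\<^sub>0 \<le> x" and i\<^sub>0: "1 \<le> i\<^sub>0" "i\<^sub>0 \<le> n"
  shows "(harm n - harm i\<^sub>0) / B \<le> (\<Sum>z\<in>S \<inter> {x + real i\<^sub>0 * B..x + real n * B}. 1 / (z - x))"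
proof -
  have "\<exists>t\<in>S. x + real i * B < t \<and> t \<le> x + real i * B + B" for i :: nat
    using x constants mult_nonneg_nonneg[of "real i" B] by (intro gap) linarith
  then obtain t where t: "\<And>i::nat. t i \<in> S" "\<And>i::nat. x + real i * B < t i"
      "\<And>i::nat. t i \<le> x + real i * B + B"
    by metis
  have less: "t i < t j" if "i < j" for i j
  proof -
    have "real (Suc i) * B \<le> real j * B"
      using that constants by (intro mult_right_mono) auto
    then show ?thesis
      using t(3)[of i] t(2)[of j] by (simp add: distrib_right)
  qed
  have inj: "inj_on t {i\<^sub>0..<n}"
    by (rule linorder_inj_onI) (use less in \<open>auto simp: less_le\<close>)
  have harm_diff: "harm n - harm i\<^sub>0 = (\<Sum>i\<in>{i\<^sub>0..<n}. 1 / (real i + 1))"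
    using i\<^sub>0(2)
  proof (induction n rule: dec_induct)
    case (step n)
    then show ?case by (simp add: harm_Suc inverse_eq_divide add.commute)
  qed simp
  have "(harm n - harm i\<^sub>0) / B = (\<Sum>i\<in>{i\<^sub>0..<n}. 1 / ((real i + 1) * B))"
    unfolding harm_diff by (simp add: sum_divide_distrib)
  also have "\<dots> \<le> (\<Sum>i\<in>{i\<^sub>0..<n}. 1 / (t i - x))"
  proof (rule sum_mono)
    fix i assume "i \<in> {i\<^sub>0..<n}"
    have "0 \<le> real i * B" using constants by simp
    then have "0 < t i - x" using t(2)[of i] by linarith
    then show "1 / ((real i + 1) * B) \<le> 1 / (t i - x)"
      using t(3)[of i] constants by (intro frac_le) (auto simp: distrib_right)
  qed
  also have "\<dots> = (\<Sum>z\<in>t ` {i\<^sub>0..<n}. 1 / (z - x))"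
    by (simp add: sum.reindex[OF inj])
  also have "\<dots> \<le> (\<Sum>z\<in>S \<inter> {x + real i\<^sub>0 * B..x + real n * B}. 1 / (z - x))"
  proof (rule sum_mono2)
    show "finite (S \<inter> {x + real i\<^sub>0 * B..x + real n * B})"
      by (rule finite_subset[OF _ finite_below[of "x + real n * B"]]) auto
    show "t ` {i\<^sub>0..<n} \<subseteq> S \<inter> {x + real i\<^sub>0 * B..x + real n * B}"
    proof (intro image_subsetI IntI t(1))
      fix i assume i: "i \<in> {i\<^sub>0..<n}"
      have "real i\<^sub>0 * B \<le> real i * B" "real (Suc i) * B \<le> real n * B"
        using i constants by (intro mult_right_mono; simp)+
      then show "t i \<in> {x + real i\<^sub>0 * B..x + real n * B}"
        using t(2,3)[of i] unfolding atLeastAtMost_iff of_nat_Suc distrib_right by linarith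
    qed
  next
    fix z assume "z \<in> S \<inter> {x + real i\<^sub>0 * B..x + real n * B} - t ` {i\<^sub>0..<n}"
    moreover have "0 \<le> real i\<^sub>0 * B" using constants by simp
    ultimately show "0 \<le> 1 / (z - x)" by auto
  qed
  finally show ?thesis .
qed

text \<open>About \<open>x / (8 * B)\<close> intervals of length \<open>B\<close> fit between
  \<open>x\<close> and \<open>9 / 8 * x\<close>. Giving away half of the logarithm absorbs the
  constant and the omitted first \<open>i\<^sub>0\<close> terms.\<close>

lemma gap_sum_ln:
  assumes i\<^sub>0: "1 \<le> i\<^sub>0"
  shows "\<forall>\<^sub>F x in at_top. ln x / (2 * B) \<le>
    (\<Sum>z\<in>S \<inter> {x + real i\<^sub>0 * B..9 / 8 * x}. 1 / (z - x))"
proof -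
  have "\<forall>\<^sub>F x in at_top. ln x / 2 \<le> ln (x / (8 * B)) - harm i\<^sub>0"
    using constants by real_asymp
  moreover have "\<forall>\<^sub>F x in at_top. x \<ge> max r\<^sub>0 (8 * B * real i\<^sub>0)"
    by (rule eventually_ge_at_top)
  ultimately show ?thesis
  proof eventually_elim
    case (elim x)
    define n where "n = nat \<lfloor>x / (8 * B)\<rfloor>"
    have x: "r\<^sub>0 \<le> x" "0 < x" "real i\<^sub>0 \<le> x / (8 * B)"
      using elim constants by (auto simp: field_simps)
    have n: "real n \<le> x / (8 * B)" "x / (8 * B) < real n + 1" "i\<^sub>0 \<le> n"
      unfolding n_def using x constants by (auto simp: le_nat_iff le_floor_iff)
    have nB: "x + real n * B \<le> 9 / 8 * x"
      using n(1) constants by (simp add: field_simps)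
    have "ln (x / (8 * B)) \<le> ln (real n + 1)"
      using n x constants by simp
    also have "\<dots> \<le> harm n"
      by (rule ln_le_harm)
    finally have "ln x / 2 \<le> harm n - harm i\<^sub>0"
      using elim by simp
    then have "ln x / 2 / B \<le> (harm n - harm i\<^sub>0) / B"
      using constants by (intro divide_right_mono) auto
    also have "\<dots> \<le> (\<Sum>z\<in>S \<inter> {x + real i\<^sub>0 * B..x + real n * B}. 1 / (z - x))"
      by (rule gap_sum) (use x n i\<^sub>0 in auto)
    also have "\<dots> \<le> (\<Sum>z\<in>S \<inter> {x + real i\<^sub>0 * B..9 / 8 * x}. 1 / (z - x))"
    proof (rule sum_mono2)
      show "finite (S \<inter> {x + real i\<^sub>0 * B..9 / 8 * x})"
        by (rule finite_subset[OF _ finite_below[of "9 / 8 * x"]]) auto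
      show "S \<inter> {x + real i\<^sub>0 * B..x + real n * B} \<subseteq> S \<inter> {x + real i\<^sub>0 * B..9 / 8 * x}"
        using nB by auto
    next
      fix z assume "z \<in> S \<inter> {x + real i\<^sub>0 * B..9 / 8 * x} - S \<inter> {x + real i\<^sub>0 * B..x + real n * B}"
      moreover have "0 \<le> real i\<^sub>0 * B" using constants by simp
      ultimately show "0 \<le> 1 / (z - x)" by auto
    qed
    finally show ?case by (simp add: mult.commute)
  qed
qed

end

locale lamperti_chain = bounded_chain M F X S K s B + lamperti_kernel S K B c \<epsilon> C r\<^sub>0 m\<^sub>0 f
  for M :: "'a measure" and F X S K s B c \<epsilon> C r\<^sub>0 m\<^sub>0 f +
  fixes N :: nat
  assumes sparse: "card (S \<inter> {..real n}) \<le> N * (n + 1)"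
begin

definition block :: "nat \<Rightarrow> 'a set" where
  "block k = {\<omega> \<in> space M. \<exists>x\<in>S \<inter> {2 ^ k<..2 ^ (k + 1)}. x \<in> cutpoints (trajectory \<omega>)}"

lemma finite_interval: "finite (S \<inter> {l<..u})"
  by (rule finite_subset[OF _ finite_below[of u]]) auto

lemma block_event [measurable]: "block k \<in> sets M"
proof -
  have "block k = (\<Union>x\<in>S \<inter> {2 ^ k<..2 ^ (k + 1)}. {\<omega> \<in> space M. x \<in> cutpoints (trajectory \<omega>)})"
    unfolding block_def by auto
  also have "\<dots> \<in> sets M"
    by (intro sets.finite_UN finite_interval cutpoint_event)
  finally show ?thesis .
qed

text \<open>The bound is \<open>card J * b / \<kappa>\<close> for
  \<open>cutpoint_block_bound\<close>. The constant 192 is 8 * 2 * 12: the count of states in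
  \<open>?J\<close>, the denominator of \<open>gap_sum_ln\<close>, and the factor of
  \<open>escape_comparison\<close>.\<close>

lemma block_prob_le:
  "\<forall>\<^sub>F k in sequentially. measure M (block k) \<le>
    (192 * real N * C * B / (c\<^sup>2 * \<epsilon> * (ln 2)\<^sup>2)) * inverse ((real k)\<^sup>2)"
proof -
  let ?i = "m\<^sub>0 + 2"
  define \<Omega> where "\<Omega> = 12 / (c\<^sup>2 * \<epsilon>)"
  have \<Omega>: "0 < \<Omega>" unfolding \<Omega>_def using constants by simp
  obtain R where R: "\<And>x. R \<le> x \<Longrightarrow> ln x / (2 * B) \<le>
      (\<Sum>z\<in>S \<inter> {x + real ?i * B..9 / 8 * x}. 1 / (z - x))"
    using gap_sum_ln[of ?i] unfolding eventually_at_top_linorder by auto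
  define R' where "R' = max R (max (r\<^sub>0 + B) (max (24 * B) (2 * (real m\<^sub>0 + 1) * B)))"
  have "filterlim (\<lambda>k::nat. 2 ^ k :: real) at_top sequentially"
    by real_asymp
  then have "\<forall>\<^sub>F k in sequentially. R' \<le> 2 ^ k"
    by (simp add: filterlim_at_top)
  moreover have "\<forall>\<^sub>F k::nat in sequentially. 0 < k"
    by (rule eventually_gt_at_top)
  ultimately show ?thesis
  proof eventually_elim
    case (elim k)
    \<comment> \<open>The block \<open>?J\<close> reaches one power of 2 further because
      \<open>z\<close> may be as large as \<open>9 / 8 * x\<close>.\<close>
    let ?I = "S \<inter> {2 ^ k<..2 ^ (k + 1)}" and ?J = "S \<inter> {2 ^ k<..2 ^ (k + 2)}"
    define \<kappa> where "\<kappa> = real k * ln 2 / (2 * B * \<Omega>)"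
    define b where "b = C / (2 ^ k * (real k * ln 2))"
    have \<kappa>: "0 < \<kappa>"
      unfolding \<kappa>_def using elim \<Omega> constants by simp
    have b: "0 \<le> b"
      unfolding b_def using constants by simp
    have "ennreal \<kappa> * emeasure M (block k) \<le> ennreal (real (card ?J) * b)"
      unfolding block_def
    proof (rule cutpoint_block_bound)
      fix x assume x: "x \<in> ?I"
      then have xR: "R \<le> x" "r\<^sub>0 + B \<le> x" "24 * B \<le> x" "2 * (real m\<^sub>0 + 1) * B \<le> x" "x \<in> S"
        using elim unfolding R'_def by auto
      let ?T = "S \<inter> {x + real ?i * B..9 / 8 * x}"
      have ln: "real k * ln 2 \<le> ln x"
        using x elim by (auto simp: ln_realpow[symmetric])
      have "\<kappa> * avg (escape x) x = real k * ln 2 / (2 * B) * (avg (escape x) x / \<Omega>)"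
        unfolding \<kappa>_def by simp
      also have "\<dots> \<le> (\<Sum>z\<in>?T. 1 / (z - x)) * (avg (escape x) x / \<Omega>)"
      proof (rule mult_right_mono)
        have "real k * ln 2 / (2 * B) \<le> ln x / (2 * B)"
          using ln constants by (intro divide_right_mono) auto
        also have "\<dots> \<le> (\<Sum>z\<in>?T. 1 / (z - x))"
          by (rule R[OF xR(1)])
        finally show "real k * ln 2 / (2 * B) \<le> (\<Sum>z\<in>?T. 1 / (z - x))" .
        show "0 \<le> avg (escape x) x / \<Omega>"
          using escape_nonneg_avg[OF xR(5)] \<Omega> by simp
      qed
      also have "\<dots> = (\<Sum>z\<in>?T. 1 / (z - x) * (avg (escape x) x / \<Omega>))"
        by (rule sum_distrib_right)
      also have "\<dots> \<le> (\<Sum>z\<in>?T. avg (hit x z) x * avg (escape z) z)"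
      proof (rule sum_mono)
        fix z assume z: "z \<in> ?T"
        have "0 < real ?i * B" using constants by simp
        then have "x < z" using z by auto
        have "avg (escape x) x \<le> \<Omega> * (z - x) * avg (escape z) z * avg (hit x z) x"
          unfolding \<Omega>_def using z by (intro escape_comparison xR) (auto simp: add.commute)
        then show "1 / (z - x) * (avg (escape x) x / \<Omega>) \<le> avg (hit x z) x * avg (escape z) z"
          using \<open>x < z\<close> \<Omega> by (simp add: field_simps)
      qed
      also have "\<dots> \<le> (\<Sum>z\<in>?J \<inter> {x<..}. avg (hit x z) x * avg (escape z) z)"
      proof (rule sum_mono2)
        show "finite (?J \<inter> {x<..})"
          using finite_interval by blast
        show "?T \<subseteq> ?J \<inter> {x<..}"
        proof
          fix z assume z: "z \<in> ?T"
          have "0 < real ?i * B" using constants by simp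
          then have "x < z" using z by auto
          then show "z \<in> ?J \<inter> {x<..}"
            using x z by auto
        qed
        show "0 \<le> avg (hit x z) x * avg (escape z) z" if "z \<in> ?J \<inter> {x<..} - ?T" for z
          using that xR(5) avg_mono[of x "\<lambda>_. 0" "hit x z"] hit_bounds escape_nonneg_avg[of z z]
          by (intro mult_nonneg_nonneg) auto
      qed
      finally show "\<kappa> * avg (escape x) x \<le> (\<Sum>z\<in>?J \<inter> {x<..}. avg (hit x z) x * avg (escape z) z)" .
    next
      fix z y assume z: "z \<in> ?J" and y: "y \<in> S" "y \<le> z + B"
      then have "2 ^ k \<le> z" "r\<^sub>0 + B \<le> z"
        using elim unfolding R'_def by auto
      have pos: "0 < z" "(0::real) < real k * ln 2"
        using \<open>2 ^ k \<le> z\<close> elim by (auto intro: less_le_trans[of 0 "2 ^ k"])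
      have "ln (2 ^ k) \<le> ln z"
        using \<open>2 ^ k \<le> z\<close> pos by simp
      then have "real k * ln 2 \<le> ln z"
        by (simp add: ln_realpow)
      have "escape z y \<le> C / (z * ln z)"
        by (rule escape_le) fact+
      also have "\<dots> \<le> b"
      proof -
        have "2 ^ k * (real k * ln 2) \<le> z * ln z"
          using \<open>2 ^ k \<le> z\<close> \<open>real k * ln 2 \<le> ln z\<close> pos by (intro mult_mono) auto
        moreover have "0 < 2 ^ k * (real k * ln 2)"
          using pos by simp
        ultimately show ?thesis
          unfolding b_def using constants(3) by (intro frac_le) auto
      qed
      finally show "escape z y \<le> b" .
    qed (use \<kappa> b finite_interval in auto)
    then have "\<kappa> * measure M (block k) \<le> real (card ?J) * b"
      using \<kappa> b by (simp add: emeasure_eq_measure ennreal_mult'[symmetric])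
    also have "real (card ?J) * b \<le> 8 * real N * 2 ^ k * b"
    proof (rule mult_right_mono[OF _ b])
      have "card ?J \<le> card (S \<inter> {..real (2 ^ (k + 2))})"
        by (intro card_mono finite_below) auto
      also have "\<dots> \<le> N * (2 ^ (k + 2) + 1)"
        by (rule sparse)
      also have "\<dots> \<le> N * (8 * 2 ^ k)"
        by (intro mult_left_mono) auto
      finally have "real (card ?J) \<le> real (N * (8 * 2 ^ k))"
        by (simp only: of_nat_le_iff)
      then show "real (card ?J) \<le> 8 * real N * 2 ^ k" by simp
    qed
    finally have "measure M (block k) \<le> 8 * real N * 2 ^ k * b / \<kappa>"
      using \<kappa> by (simp add: pos_le_divide_eq mult.commute)
    also have "\<dots> = (192 * real N * C * B / (c\<^sup>2 * \<epsilon> * (ln 2)\<^sup>2)) * inverse ((real k)\<^sup>2)"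
      unfolding b_def \<kappa>_def \<Omega>_def using constants elim
      by (simp add: field_simps power2_eq_square)
    finally show ?case .
  qed
qed

theorem AE_finite_cutpoints: "AE \<omega> in M. finite (cutpoints (trajectory \<omega>))"
proof -
  have "summable (\<lambda>k. measure M (block k))"
  proof (rule summable_comparison_test_ev)
    show "\<forall>\<^sub>F k in sequentially. norm (measure M (block k)) \<le>
      (192 * real N * C * B / (c\<^sup>2 * \<epsilon> * (ln 2)\<^sup>2)) * inverse ((real k)\<^sup>2)"
      using block_prob_le by simp
    show "summable (\<lambda>k. (192 * real N * C * B / (c\<^sup>2 * \<epsilon> * (ln 2)\<^sup>2)) * inverse ((real k)\<^sup>2))"
      by (intro summable_mult inverse_power_summable) simp
  qed
  then have "AE \<omega> in M. \<forall>\<^sub>F k in sequentially. \<omega> \<in> space M - block k"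
    by (intro borel_cantelli_AE1 block_event) (auto simp: emeasure_eq_measure)
  then show ?thesis
  proof eventually_elim
    case (elim \<omega>)
    then obtain k\<^sub>1 where k\<^sub>1: "\<And>k. k \<ge> k\<^sub>1 \<Longrightarrow> \<omega> \<in> space M - block k"
      unfolding eventually_sequentially by blast
    have \<omega>: "\<omega> \<in> space M" using k\<^sub>1 by blast
    have "cutpoints (trajectory \<omega>) \<subseteq> S \<inter> {..2 ^ k\<^sub>1}"
    proof
      fix x assume x: "x \<in> cutpoints (trajectory \<omega>)"
      then have xS: "x \<in> S"
        unfolding cutpoints_def using state[OF \<omega>] by auto
      have "x \<le> 2 ^ k\<^sub>1"
      proof (rule ccontr)
        assume large: "\<not> x \<le> 2 ^ k\<^sub>1"
        have "\<exists>n. x < 2 ^ n" by (rule real_arch_pow) simp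
        then obtain n where n: "x \<le> 2 ^ n" by (auto intro: less_imp_le)
        \<comment> \<open>Minimality puts \<open>x\<close> into \<open>(2 ^ (k - 1), 2 ^ k]\<close>,
          that is, into block number \<open>k - 1\<close>, which is still at least
          \<open>k\<^sub>1\<close>.\<close>
        define k where "k = (LEAST n. x \<le> 2 ^ n)"
        have k: "x \<le> 2 ^ k"
          unfolding k_def by (rule LeastI[of _ n]) (rule n)
        have "k\<^sub>1 < k"
        proof (rule ccontr)
          assume "\<not> k\<^sub>1 < k"
          then have "(2::real) ^ k \<le> 2 ^ k\<^sub>1" by (intro power_increasing) auto
          with k large show False by simp
        qed
        moreover have "\<not> x \<le> 2 ^ (k - 1)"
          using not_less_Least[of "k - 1" "\<lambda>n. x \<le> 2 ^ n"] \<open>k\<^sub>1 < k\<close> unfolding k_def by simp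
        ultimately have "\<omega> \<in> block (k - 1)"
          unfolding block_def using x xS k \<omega> by auto
        moreover have "\<omega> \<in> space M - block (k - 1)"
          by (rule k\<^sub>1) (use \<open>k\<^sub>1 < k\<close> in simp)
        ultimately show False by blast
      qed
      then show "x \<in> S \<inter> {..2 ^ k\<^sub>1}" using xS by simp
    qed
    then show ?case by (rule finite_subset[OF _ finite_below])
  qed
qed

end

section \<open>Finiteness of the set of cutpoints\<close>

lemma uniformly_locally_finite_card:
  assumes "\<And>x. 0 \<le> x \<Longrightarrow> finite (S \<inter> {x..x + 1}) \<and> card (S \<inter> {x..x + 1}) \<le> N" "0 \<le> x"
  shows "finite (S \<inter> {x..x + real n}) \<and> card (S \<inter> {x..x + real n}) \<le> N * (n + 1)"
proof (induction n)
  case 0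
  have "S \<inter> {x..x} \<subseteq> S \<inter> {x..x + 1}" by auto
  then show ?case
    using assms(1)[OF \<open>0 \<le> x\<close>] card_mono[of "S \<inter> {x..x + 1}" "S \<inter> {x..x}"]
    by (auto intro: finite_subset)
next
  case (Suc n)
  let ?A = "S \<inter> {x..x + real n}" and ?B = "S \<inter> {x + real n..x + real n + 1}"
  have B: "finite ?B" "card ?B \<le> N"
    using assms by auto
  have eq: "S \<inter> {x..x + real (Suc n)} = ?A \<union> ?B" by auto
  have "card (?A \<union> ?B) \<le> card ?A + card ?B" by (rule card_Un_le)
  then show ?case
    unfolding eq using Suc B by auto
qed

lemma path_reachable:
  "w \<in> set_pmf (path_pmf K n x) \<Longrightarrow> (x, w ! n) \<in> {(a, b). b \<in> set_pmf (K a)}\<^sup>*"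
proof (induction n arbitrary: x w)
  case (Suc n)
  then obtain y w' where y: "y \<in> set_pmf (K x)" "w' \<in> set_pmf (path_pmf K n y)" "w = x # w'"
    by auto
  then have "(x, y) \<in> {(a, b). b \<in> set_pmf (K a)}" by simp
  also have "(y, w' ! n) \<in> {(a, b). b \<in> set_pmf (K a)}\<^sup>*" by (rule Suc.IH[OF y(2)])
  finally show ?case using y(3) by simp
qed simp

theorem theorem1p3:
  fixes M :: "'a measure" and F :: "nat \<Rightarrow> 'a measure" and X :: "nat \<Rightarrow> 'a \<Rightarrow> real"
    and S :: "real set" and s :: "nat \<Rightarrow> real" and K :: "real \<Rightarrow> real pmf"
    and B x\<^sub>0 D :: real
  assumes chain: "markov_chain M F S K X" and irreducible: "irreducible_chain S K"
    and states: "S \<subseteq> {0..}" "\<not> bdd_above S" "uniformly_locally_finite S"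
    and enumeration: "strict_mono s" "range s = S" "s 0 = 0"
    and up_step: "\<exists>k\<^sub>0 m\<^sub>0 :: nat. \<exists>\<delta>\<^sub>0 > (0::real). \<forall>k\<ge>k\<^sub>0. \<exists>m. 1 \<le> m \<and> m \<le> m\<^sub>0 \<and>
      \<P>(w in path_pmf K m (s k). w ! m = s (k + 1) \<and> (MAX l\<in>{0..m - 1}. w ! l) \<le> s k) > \<delta>\<^sub>0"
    and bounded_jumps: "\<forall>n. \<P>(\<omega> in M. \<bar>X (n + 1) \<omega> - X n \<omega>\<bar> \<le> B) = 1"
    and variance: "Liminf (inf at_top (principal S)) (\<lambda>x. ereal (increment_moment K 2 x)) > 0"
    and x\<^sub>0: "x\<^sub>0 \<ge> 0"
    and drift: "\<forall>x\<in>S. x \<ge> x\<^sub>0 \<longrightarrow>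
      increment_moment K 1 x \<ge> 0 \<and>
      2 * x * increment_moment K 1 x - increment_moment K 2 x \<le> D / ln x"
  shows "\<P>(\<omega> in M. finite (cutpoints (\<lambda>n. X n \<omega>))) = 1"
proof -
  interpret countable_chain M F X S K s
    using chain enumeration by unfold_locales (auto simp: strict_mono_imp_inj_on)
  obtain N where N: "\<And>x. 0 \<le> x \<Longrightarrow> finite (S \<inter> {x..x + 1}) \<and> card (S \<inter> {x..x + 1}) \<le> N"
    using states(3) unfolding uniformly_locally_finite_def by blast
  obtain k\<^sub>0 m\<^sub>0 :: nat and \<delta> :: real where \<delta>: "0 < \<delta>"
    and climb_prob: "\<And>k. k \<ge> k\<^sub>0 \<Longrightarrow> \<exists>m. 1 \<le> m \<and> m \<le> m\<^sub>0 \<and>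
      \<P>(w in path_pmf K m (s k). w ! m = s (k + 1) \<and> (MAX l\<in>{0..m - 1}. w ! l) \<le> s k) > \<delta>"
    using up_step by blast
  have "\<delta> \<le> 1"
    using climb_prob[OF order_refl] measure_pmf.prob_le_1 by (meson less_imp_le order_trans)
  \<comment> \<open>Enlarging the jump bound secures its positivity.\<close>
  define B' where "B' = max B 1"
  have B': "0 < B'" unfolding B'_def by simp
  have jumps: "AE \<omega> in M. \<bar>X (Suc n) \<omega> - X n \<omega>\<bar> \<le> B'" for n
  proof -
    have "\<P>(\<omega> in M. \<bar>X (Suc n) \<omega> - X n \<omega>\<bar> \<le> B) = 1"
      using bounded_jumps by simp
    moreover have "Measurable.pred M (\<lambda>\<omega>. \<bar>X (Suc n) \<omega> - X n \<omega>\<bar> \<le> B)"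
      using measurable_comp_X[of "\<lambda>x. x"] by measurable
    ultimately have "AE \<omega> in M. \<bar>X (Suc n) \<omega> - X n \<omega>\<bar> \<le> B"
      by (simp add: prob_Collect_eq_1)
    then show ?thesis by eventually_elim (simp add: B'_def)
  qed
  have reach: "(x, y) \<in> {(a, b). b \<in> set_pmf (K a)}\<^sup>*" if "x \<in> S" "y \<in> S" for x y
  proof -
    have "\<exists>n. \<P>(w in path_pmf K n x. w ! n = y) > 0"
      using irreducible that unfolding irreducible_chain_def by simp
    then obtain n where "\<P>(w in path_pmf K n x. w ! n = y) > 0" ..
    then have "measure (measure_pmf (path_pmf K n x)) {w. w ! n = y} \<noteq> 0"
      by simp
    then obtain w where "w \<in> set_pmf (path_pmf K n x)" "w ! n = y"
      unfolding measure_pmf_zero_iff by blast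
    then show ?thesis using path_reachable by blast
  qed
  have sparse: "finite (S \<inter> {..real n}) \<and> card (S \<inter> {..real n}) \<le> N * (n + 1)" for n
  proof -
    have "S \<inter> {..real n} = S \<inter> {0..0 + real n}" using states(1) by auto
    then show ?thesis using uniformly_locally_finite_card[OF N, of 0 n] by simp
  qed
  interpret bounded_kernel S K B'
  proof
    show "finite (S \<inter> {..r})" for r
    proof -
      obtain n :: nat where "r \<le> real n" using real_arch_simple by blast
      then have "S \<inter> {..r} \<subseteq> S \<inter> {..real n}" by auto
      then show ?thesis using sparse finite_subset by blast
    qed
    show "\<bar>y - x\<bar> \<le> B'" if "x \<in> S" "y \<in> set_pmf (K x)" for x y
      by (rule kernel_jump[OF _ jumps that]) (use reach that in blast)
  qed (use states(2) kernel_closed reach in auto)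
  have moment: "increment_moment K 1 x = avg (\<lambda>y. y) x - x" if "x \<in> S" for x
    unfolding increment_moment_def by (simp add: integrable_kernel[OF that])

  obtain \<epsilon>' :: real where \<epsilon>': "0 < ereal \<epsilon>'"
      "ereal \<epsilon>' < Liminf (inf at_top (principal S)) (\<lambda>x. ereal (increment_moment K 2 x))"
    using ereal_dense2[OF variance] by blast
  from less_LiminfD[OF \<epsilon>'(2)]
  have "\<forall>\<^sub>F x in at_top. x \<in> S \<longrightarrow> \<epsilon>' < increment_moment K 2 x"
    by (simp add: eventually_inf_principal)
  then have ev_variance: "\<forall>\<^sub>F x in at_top. x \<in> S \<longrightarrow> \<epsilon>' \<le> increment_moment K 2 x"
    by eventually_elim auto
  \<comment> \<open>Chosen for \<open>lyapunov_supermartingale\<close>; the maximum with 1 keeps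
    \<open>a\<close> positive if \<open>D + 1\<close> is not.\<close>
  define a where "a = max 1 ((D + 1) / \<epsilon>')"
  have a: "0 < a" "D + 1 \<le> (a + 1) * \<epsilon>'"
  proof -
    show "0 < a" unfolding a_def by simp
    have "(D + 1) / \<epsilon>' \<le> a + 1" unfolding a_def by simp
    then show "D + 1 \<le> (a + 1) * \<epsilon>'" using \<epsilon>'(1) by (simp add: pos_divide_le_eq)
  qed
  let ?f = "lyapunov a"
  have "\<forall>\<^sub>F x in at_top. x \<ge> max 2 (max (s k\<^sub>0) x\<^sub>0)"
    by (rule eventually_ge_at_top)
  then have "\<forall>\<^sub>F x in at_top. x \<ge> max 2 (max (s k\<^sub>0) x\<^sub>0) \<and>
      (x \<in> S \<longrightarrow> \<epsilon>' \<le> increment_moment K 2 x \<and> avg ?f x \<le> ?f x) \<and>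
      (?f (x + B') - ?f (x - B')) / - ?f (x - B') \<le> 8 * a * B' / (x * ln x) \<and>
      (\<forall>w. x - B' \<le> w \<longrightarrow> w \<le> 2 * x \<longrightarrow>
        ?f w - ?f (x - B') \<le> 3 * (w - x + B') / x * (?f (2 * x) - ?f (x - B')))"
    using ev_variance lyapunov_local[OF a(1) B'] lyapunov_doubling[OF a(1) B']
      lyapunov_supermartingale[OF a(1) B' a(2)]
  proof eventually_elim
    case (elim x)
    have "avg ?f x \<le> ?f x" if "x \<in> S"
      using elim(1,2) elim(5)[rule_format, of "K x"] drift finite_support[OF that] jump[OF that] that
      unfolding increment_moment_def by auto
    then show ?case using elim by blast
  qed
  then obtain r where r: "\<And>x. r \<le> x \<Longrightarrow> x \<ge> max 2 (max (s k\<^sub>0) x\<^sub>0) \<and>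
      (x \<in> S \<longrightarrow> \<epsilon>' \<le> increment_moment K 2 x \<and> avg ?f x \<le> ?f x) \<and>
      (?f (x + B') - ?f (x - B')) / - ?f (x - B') \<le> 8 * a * B' / (x * ln x) \<and>
      (\<forall>w. x - B' \<le> w \<longrightarrow> w \<le> 2 * x \<longrightarrow>
        ?f w - ?f (x - B') \<le> 3 * (w - x + B') / x * (?f (2 * x) - ?f (x - B')))"
    unfolding eventually_at_top_linorder by blast
  have r_ge: "2 \<le> x" "s k\<^sub>0 \<le> x" "x\<^sub>0 \<le> x" if "r \<le> x" for x
    using r[OF that] by auto
  obtain q :: nat where q: "2 * B' \<le> real q" using real_arch_simple by blast
  \<comment> \<open>No interval of length \<open>2 * B'\<close> starting in a nonnegative point
    contains more than \<open>N'\<close> states, so a climb over this distance costs at most the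
    factor \<open>\<delta> ^ N'\<close>.\<close>
  define N' where "N' = N * (q + 1)"

  interpret lamperti_chain M F X S K s B' "\<delta> ^ N'" "\<epsilon>' / (2 * B')" "8 * a * B'" r m\<^sub>0 ?f N
  proof
    fix w t and \<phi> :: "real \<Rightarrow> real"
    assume w: "w \<in> S" "t \<in> S" "r \<le> w" "w \<le> t" "t \<le> w + 2 * B'"
      and \<phi>: "\<And>y. y \<in> S \<Longrightarrow> 0 \<le> \<phi> y"
        "\<And>y. y \<in> S \<Longrightarrow> w - real m\<^sub>0 * B' \<le> y \<Longrightarrow> y < t \<Longrightarrow> avg \<phi> y \<le> \<phi> y"
    obtain i j where ij: "w = s i" "t = s j" using w enumeration(2) by auto
    have "i \<le> j" "k\<^sub>0 \<le> i"
      using w r_ge[of w] ij enumeration(1) by (auto simp: strict_mono_less_eq)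
    have "s ` {i..j} \<subseteq> S \<inter> {w..w + real q}"
    proof
      fix y assume "y \<in> s ` {i..j}"
      then have "y \<in> S" "w \<le> y" "y \<le> t"
        using ij enumeration by (auto simp: strict_mono_less_eq)
      then show "y \<in> S \<inter> {w..w + real q}" using w q by auto
    qed
    moreover have "0 \<le> w" using w(1) states(1) by auto
    moreover have "card (s ` {i..j}) = card {i..j}"
      by (rule card_image) (use inj_s in \<open>auto intro: inj_on_subset\<close>)
    ultimately have "card {i..j} \<le> N'"
      unfolding N'_def using uniformly_locally_finite_card[OF N, of w q]
      by (metis card_mono order_trans)
    then have "\<delta> ^ N' \<le> \<delta> ^ (j - i)"
      using \<delta> \<open>\<delta> \<le> 1\<close> by (intro power_decreasing) auto
    then have "\<delta> ^ N' * \<phi> t \<le> \<delta> ^ (j - i) * \<phi> t"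
      using \<phi>(1) w by (intro mult_right_mono) auto
    also have "\<dots> \<le> \<phi> w"
    proof -
      have "\<delta> ^ (j - i) * \<phi> (s (i + (j - i))) \<le> \<phi> (s i)"
        by (rule climb[OF enumeration(1,2) climb_prob less_imp_le[OF \<delta>] \<open>k\<^sub>0 \<le> i\<close> \<phi>(1)])
           (use \<phi>(2) ij \<open>i \<le> j\<close> in auto)
      then show ?thesis using ij \<open>i \<le> j\<close> by simp
    qed
    finally show "\<delta> ^ N' * \<phi> t \<le> \<phi> w" .
  next
    fix u assume u: "r \<le> u"
    have "finite {k. s k \<le> u}"
    proof (rule finite_imageD[of s])
      show "finite (s ` {k. s k \<le> u})"
        by (rule finite_subset[OF _ finite_below[of u]]) (use enumeration in auto)
      show "inj_on s {k. s k \<le> u}" using inj_s by (rule inj_on_subset) simp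
    qed
    moreover have "k\<^sub>0 \<in> {k. s k \<le> u}" using r_ge[OF u] by simp
    moreover define k where "k = Max {k. s k \<le> u}"
    ultimately have k: "s k \<le> u" "k\<^sub>0 \<le> k" "\<not> s (Suc k) \<le> u"
      using Max_in[of "{k. s k \<le> u}"] Max_ge[of "{k. s k \<le> u}"] by (auto, fastforce)
    \<comment> \<open>A path realising the upward step from \<open>s k\<close> is at or below
      \<open>s k\<close> just before it arrives at \<open>s (k + 1)\<close>, so a single jump
      bridges the gap between these neighbours.\<close>
    obtain m where m: "1 \<le> m"
      "\<P>(w in path_pmf K m (s k). w ! m = s (k + 1) \<and> (MAX l\<in>{0..m - 1}. w ! l) \<le> s k) > \<delta>"
      using climb_prob[OF k(2)] by blast
    then have "measure (measure_pmf (path_pmf K m (s k)))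
        {w. w ! m = s (k + 1) \<and> (MAX l\<in>{0..m - 1}. w ! l) \<le> s k} \<noteq> 0"
      using \<delta> by simp
    then obtain w where w: "w \<in> set_pmf (path_pmf K m (s k))" "w ! m = s (k + 1)"
        "(MAX l\<in>{0..m - 1}. w ! l) \<le> s k"
      unfolding measure_pmf_zero_iff by blast
    have "w ! (m - 1) \<le> s k"
      using w(3) by (subst (asm) Max_le_iff) auto
    moreover have "\<bar>w ! m - w ! (m - 1)\<bar> \<le> B'"
      using path_steps[OF _ w(1), of "m - 1"] m(1) enumeration(2) by auto
    ultimately show "\<exists>t\<in>S. u < t \<and> t \<le> u + B'"
      using k w(2) enumeration(2) by (intro bexI[of _ "s (k + 1)"]) auto
  next
    fix x assume x: "x \<in> S" "r \<le> x"
    have \<mu>: "0 \<le> increment_moment K 1 x" "\<epsilon>' \<le> increment_moment K 2 x" "avg ?f x \<le> ?f x"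
      using x r[of x] r_ge[of x] drift by auto
    show "avg ?f x \<le> ?f x" by (rule \<mu>)
    show "x \<le> avg (\<lambda>y. y) x" using \<mu>(1) moment[OF x(1)] by simp
    \<comment> \<open>The square of the increment is at most \<open>B'\<close> times its absolute
      value, which is twice the positive part minus the increment. Since mu_1 is nonnegative, the
      lower bound on mu_2 passes to the mean positive part.\<close>
    have "increment_moment K 2 x \<le> avg (\<lambda>y. B' * (2 * max 0 (y - x) - (y - x) ^ 1)) x"
      unfolding increment_moment_def
    proof (rule avg_mono[OF x(1)])
      fix y assume "\<bar>y - x\<bar> \<le> B'"
      then have "\<bar>y - x\<bar> * \<bar>y - x\<bar> \<le> B' * \<bar>y - x\<bar>" by (intro mult_right_mono) auto
      moreover have "2 * max 0 (y - x) - (y - x) ^ 1 = \<bar>y - x\<bar>" by (auto simp: max_def)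
      moreover have "(y - x)\<^sup>2 = \<bar>y - x\<bar> * \<bar>y - x\<bar>" by (simp add: power2_eq_square)
      ultimately show "(y - x)\<^sup>2 \<le> B' * (2 * max 0 (y - x) - (y - x) ^ 1)" by (simp only:)
    qed
    also have "\<dots> = B' * (2 * avg (\<lambda>y. max 0 (y - x)) x - increment_moment K 1 x)"
      unfolding increment_moment_def by (simp add: integrable_kernel[OF x(1)])
    also have "\<dots> \<le> B' * (2 * avg (\<lambda>y. max 0 (y - x)) x)"
      using \<mu>(1) B' by (intro mult_left_mono) auto
    finally show "\<epsilon>' / (2 * B') \<le> avg (\<lambda>y. max 0 (y - x)) x"
      using \<mu>(2) B' by (simp add: field_simps)
  next
    show "1 \<le> r" using r_ge[of r] by simp
    show "?f x < ?f y" if "r \<le> x" "x < y" for x y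
      using that r_ge[of x] a by (intro lyapunov_strict_mono) auto
    show "?f x < 0" if "r \<le> x" for x
      using r_ge[OF that] by (intro lyapunov_neg) auto
    show "(?f (x + B') - ?f (x - B')) / - ?f (x - B') \<le> 8 * a * B' / (x * ln x)" if "r + B' \<le> x" for x
      using r[of x] that B' by auto
    show "?f w - ?f (x - B') \<le> 3 * (w - x + B') / x * (?f (2 * x) - ?f (x - B'))"
      if "r + B' \<le> x" "x - B' \<le> w" "w \<le> 2 * x" for x w
      using r[of x] that B' by auto
  qed (use a B' \<delta> \<epsilon>' jumps states(1) sparse lyapunov_tendsto in auto)
  from AE_finite_cutpoints show ?thesis
    by (subst prob_Collect_eq_1[OF finite_cutpoints_event])
qed

end
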